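(* For every $n\geq 1$, the Lusternik-Schnirelmann category of the unitary group satisfies $\mathrm{cat}\, U(n)=n$.
   Context: For a topological space $X$, an open set $U\subset X$ is called categorical when it is contractible in $X$ (the inclusion $U\hookrightarrow X$ is homotopic to a constant map). The LS category $\mathrm{cat}\, X$ is the minimum number, minus one, of categorical open sets needed to cover $X$. *)

theory Defs
  imports "HOL-Analysis.Analysis" "HOL-Library.Extended_Nat"
begin

definition conj_transpose :: "complex ^ 'n ^ 'm \<Rightarrow> complex ^ 'm ^ 'n" where
  "conj_transpose A = (\<chi> i j. cnj (A $ j $ i))"

definition unitary_group :: "(complex ^ 'n ^ 'n) set" where
  "unitary_group = {A. conj_transpose A ** A = mat 1 \<and> A ** conj_transpose A = mat 1}"

definition categorical :: "'a topology \<Rightarrow> 'a set \<Rightarrow> bool" where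
  "categorical X U \<longleftrightarrow>
     openin X U \<and> (\<exists>a. homotopic_with (\<lambda>_. True) (subtopology X U) X id (\<lambda>_. a))"

text \<open>The value is \<open>\<infinity>\<close> if there is no finite categorical cover. As \<open>-\<close> on \<^typ>\<open>enat\<close>
  truncates, the empty space gets the value \<open>0\<close> rather than \<open>-1\<close>; for nonempty
  spaces the subtraction is genuine.\<close>

definition LS_cat :: "'a topology \<Rightarrow> enat" where
  "LS_cat X =
     (INF \<U> \<in> {\<U>. finite \<U> \<and> (\<forall>U\<in>\<U>. categorical X U) \<and> \<Union>\<U> = topspace X}. enat (card \<U>)) - 1"

end

theory Submission
  imports Defs
begin

text \<open>
  Upper bound: a unitary matrix has at most \<open>n\<close> eigenvalues, so among \<open>n + 1\<close> fixed points of the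
  unit circle one is not an eigenvalue, and the matrices avoiding a given eigenvalue contract along
  a Cayley transform.

  Lower bound: \<open>n\<close> categorical sets covering \<open>U(n)\<close> yield deformations \<open>K\<^sub>i\<close> of the identity such that
  for every \<open>A\<close> some \<open>K\<^sub>i(1, A)\<close> is a fixed matrix \<open>a\<^sub>i\<close>. Choose distinct \<open>\<lambda>\<^sub>i\<close> on the unit circle with
  \<open>\<lambda>\<^sub>i\<close> not an eigenvalue of \<open>a\<^sub>i\<close>. The matrices having a \<open>\<lambda>\<^sub>i\<close>-eigenvector in the span of
  \<open>e\<^sub>i, \<dots>, e\<^sub>n\<close> form a cycle of codimension \<open>2 i - 1\<close>; these \<open>n\<close> cycles are dual to the generators of the
  cohomology ring and meet transversally in the single matrix \<open>diag(\<lambda>\<^sub>1, \<dots>, \<lambda>\<^sub>n)\<close>. By a degree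
  argument their preimages under the maps \<open>K\<^sub>i(1, _)\<close> still have a common point, which is impossible.

  For the degree argument the \<open>i\<close>-th eigenvector is normalised to have \<open>i\<close>-th entry 1, which turns the
  problem into equations on a Euclidean space. Solutions could escape to infinity in this affine chart
  of projective space, but this is a condition of real codimension 2, so that a generic
  perturbation rules it out along a one-parameter family.
\<close>

section \<open>Zeros of homotopies\<close>

lemma homotopic_with_canonI:
  fixes k :: "real \<times> 'a::topological_space \<Rightarrow> 'b::topological_space"
  assumes "continuous_on ({0..1} \<times> S) k" "k ` ({0..1} \<times> S) \<subseteq> T"
    "\<And>x. x \<in> S \<Longrightarrow> k (0, x) = f x" "\<And>x. x \<in> S \<Longrightarrow> k (1, x) = g x"
  shows "homotopic_with_canon (\<lambda>_. True) S T f g"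
  using assms by (subst homotopic_with) (auto intro!: exI[of _ k])


lemma compact_positive_lower_bound:
  fixes f :: "'a::topological_space \<Rightarrow> real"
  assumes "compact K" "continuous_on K f" "\<And>x. x \<in> K \<Longrightarrow> 0 < f x"
  shows "\<exists>c>0. \<forall>x\<in>K. c \<le> f x"
proof (cases "K = {}")
  case True
  then show ?thesis by (auto intro: exI[of _ 1])
next
  case False
  then obtain y where "y \<in> K" "\<And>x. x \<in> K \<Longrightarrow> f y \<le> f x"
    using continuous_attains_inf[OF assms(1) False assms(2)] by auto
  then show ?thesis using assms(3) by blast
qed

text \<open>Degree theory by hand: without a zero at time 1, the map taking \<open>u\<close> to
  \<open>h (1, p + r u)\<close> on the unit sphere would be null-homotopic in the punctured space.
  Following it back to time 0 and shrinking the sphere around \<open>p\<close> turns it into the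
  linear isomorphism \<open>L\<close>, so the sphere would be contractible.\<close>

lemma zero_of_homotopy_from_nondegenerate_zero:
  fixes h :: "real \<times> 'a::euclidean_space \<Rightarrow> 'a"
  assumes cont: "continuous_on ({0..1} \<times> UNIV) h"
    and bounded: "\<And>t x. t \<in> {0..1} \<Longrightarrow> h (t, x) = 0 \<Longrightarrow> norm (x - p) < r"
    and zero: "\<And>x. h (0, x) = 0 \<longleftrightarrow> x = p"
    and deriv: "((\<lambda>x. h (0, x)) has_derivative L) (at p)"
    and inj: "inj L"
  shows "\<exists>x. h (1, x) = 0"
proof (rule ccontr)
  assume no_zero: "\<not> ?thesis"
  define S where "S = sphere (0::'a) 1"
  have S: "norm u = 1" if "u \<in> S" for u
    using that by (simp add: S_def)
  have r: "0 < r"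
    using bounded[of 0 p] zero by simp
  have "linear L"
    using deriv has_derivative_linear by blast
  then obtain L' where "linear L'" and L': "\<And>x. L' (L x) = x"
    using linear_injective_left_inverse[OF _ inj] by (metis comp_apply id_apply)
  have L0: "L x = 0 \<longleftrightarrow> x = 0" for x
    by (metis L' \<open>linear L\<close> linear_0)
  have "surj L"
    using linear_inj_imp_surj[OF \<open>linear L\<close> inj] .
  then have L'0: "L' y = 0 \<longleftrightarrow> y = 0" for y
    by (metis L' L0 surj_def)
  obtain B where "0 < B" and B: "\<And>x. B * norm x \<le> norm (L x)"
    using linear_inj_bounded_below_pos[OF \<open>linear L\<close> inj] by metis
  have "\<forall>\<^sub>F x in at p. norm (h (0, x) - h (0, p) - L (x - p)) / norm (x - p) < B"
    using deriv \<open>0 < B\<close> unfolding has_derivative_iff_norm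
    by (auto simp: order_tendsto_iff)
  then obtain d where "0 < d" and d: "\<And>x. x \<noteq> p \<Longrightarrow> dist x p < d \<Longrightarrow>
      norm (h (0, x) - h (0, p) - L (x - p)) / norm (x - p) < B"
    unfolding eventually_at by auto
  define e where "e = d / 2"
  have e: "0 < e" using \<open>0 < d\<close> by (simp add: e_def)
  have h0: "h (0, p) = 0" by (simp add: zero)
  have S0: "u \<noteq> 0" if "u \<in> S" for u using S[OF that] by auto
  \<comment> \<open>On the sphere of radius \<open>e\<close> the linearisation error is smaller than
    the linear part, so the segment joining \<open>h\<close> to \<open>L\<close> misses 0.\<close>
  have ne: "norm (h (0, p + e *\<^sub>R u) - L (e *\<^sub>R u)) < norm (L (e *\<^sub>R u))" if "u \<in> S" for u
  proof -
    have "norm (h (0, p + e *\<^sub>R u) - L (e *\<^sub>R u)) < B * norm (e *\<^sub>R u)"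
      using d[of "p + e *\<^sub>R u"] e S[OF that] S0[OF that] h0 by (auto simp: dist_norm e_def divide_simps)
    also have "\<dots> \<le> norm (L (e *\<^sub>R u))" by (rule B)
    finally show ?thesis .
  qed
  \<comment> \<open>Each of the following homotopies misses 0 for its own reason: on the sphere of
    radius \<open>r\<close> by the a priori bound, at time 1 by assumption, at time 0 because
    \<open>p\<close> is the only zero, and finally by \<open>ne\<close>.\<close>
  let ?hom = "homotopic_with_canon (\<lambda>_. True) S (- {0::'a})"
  have "?hom (\<lambda>u. h (0, p + r *\<^sub>R u)) (\<lambda>u. h (1, p + r *\<^sub>R u))"
  proof (rule homotopic_with_canonI[where k = "\<lambda>z. h (fst z, p + r *\<^sub>R snd z)"])
    show "continuous_on ({0..1} \<times> S) (\<lambda>z. h (fst z, p + r *\<^sub>R snd z))"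
      by (intro continuous_on_compose2[OF cont] continuous_intros) auto
    have "h (t, p + r *\<^sub>R u) \<noteq> 0" if "t \<in> {0..1}" "u \<in> S" for t u
      using bounded[OF that(1), of "p + r *\<^sub>R u"] r S[OF that(2)] by auto
    then show "(\<lambda>z. h (fst z, p + r *\<^sub>R snd z)) ` ({0..1} \<times> S) \<subseteq> - {0}"
      by auto
  qed auto
  then have 1: "?hom (\<lambda>u. h (1, p + r *\<^sub>R u)) (\<lambda>u. h (0, p + r *\<^sub>R u))"
    by (rule homotopic_with_symD)
  have 2: "?hom (\<lambda>u. h (1, p + r *\<^sub>R u)) (\<lambda>u. h (1, p))"
  proof (rule homotopic_with_canonI[where k = "\<lambda>z. h (1, p + ((1 - fst z) * r) *\<^sub>R snd z)"])
    show "continuous_on ({0..1} \<times> S) (\<lambda>z. h (1, p + ((1 - fst z) * r) *\<^sub>R snd z))"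
      by (intro continuous_on_compose2[OF cont] continuous_intros) auto
  qed (use no_zero in auto)
  have 3: "?hom (\<lambda>u. h (0, p + r *\<^sub>R u)) (\<lambda>u. h (0, p + e *\<^sub>R u))"
  proof (rule homotopic_with_canonI[where k = "\<lambda>z. h (0, p + ((1 - fst z) * r + fst z * e) *\<^sub>R snd z)"])
    show "continuous_on ({0..1} \<times> S) (\<lambda>z. h (0, p + ((1 - fst z) * r + fst z * e) *\<^sub>R snd z))"
      by (intro continuous_on_compose2[OF cont] continuous_intros) auto
    have "(1 - t) * r + t * e \<noteq> 0" if "t \<in> {0..1}" for t
      using that r e by (cases "t = 1") (auto intro!: add_pos_nonneg less_imp_neq[symmetric])
    then show "(\<lambda>z. h (0, p + ((1 - fst z) * r + fst z * e) *\<^sub>R snd z)) ` ({0..1} \<times> S) \<subseteq> - {0}"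
      using S0 by (auto simp: zero)
  qed auto
  have 4: "?hom (\<lambda>u. h (0, p + e *\<^sub>R u)) (\<lambda>u. L (e *\<^sub>R u))"
  proof (rule homotopic_with_linear)
    show "continuous_on S (\<lambda>u. h (0, p + e *\<^sub>R u))"
      by (intro continuous_on_compose2[OF cont] continuous_intros) auto
    show "continuous_on S (\<lambda>u. L (e *\<^sub>R u))"
      by (rule linear_continuous_on_compose[OF _ \<open>linear L\<close>]) (intro continuous_intros)
    show "closed_segment (h (0, p + e *\<^sub>R u)) (L (e *\<^sub>R u)) \<subseteq> - {0}" if "u \<in> S" for u
    proof -
      have "0 \<notin> closed_segment (h (0, p + e *\<^sub>R u)) (L (e *\<^sub>R u))"
        using ne[OF that] segment_bound(2)[of 0 "h (0, p + e *\<^sub>R u)" "L (e *\<^sub>R u)"]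
        by (auto simp: norm_minus_commute)
      then show ?thesis by auto
    qed
  qed
  have "?hom (\<lambda>u. L (e *\<^sub>R u)) (\<lambda>u. h (1, p))"
    by (rule homotopic_with_symD[OF homotopic_with_trans[OF homotopic_with_trans[OF
          homotopic_with_trans[OF homotopic_with_symD[OF 2] 1] 3] 4]])
  \<comment> \<open>Applying \<open>L'\<close> and normalising turns the linear map into the
    identity of the sphere and keeps the constant map constant.\<close>
  then have "homotopic_with_canon (\<lambda>_. True) S S
      ((\<lambda>y. L' y /\<^sub>R norm (L' y)) \<circ> (\<lambda>u. L (e *\<^sub>R u))) ((\<lambda>y. L' y /\<^sub>R norm (L' y)) \<circ> (\<lambda>u. h (1, p)))"
  proof (rule homotopic_with_compose_continuous_left)
    show "continuous_on (- {0}) (\<lambda>y. L' y /\<^sub>R norm (L' y))"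
      by (intro continuous_intros linear_continuous_on[OF linear_conv_bounded_linear[THEN iffD1, OF \<open>linear L'\<close>]])
        (auto simp: L'0)
    show "(\<lambda>y. L' y /\<^sub>R norm (L' y)) \<in> - {0} \<rightarrow> S"
      by (auto simp: S_def L'0)
  qed
  then have "homotopic_with_canon (\<lambda>_. True) S S id (\<lambda>u. L' (h (1, p)) /\<^sub>R norm (L' (h (1, p))))"
    by (rule homotopic_with_eq) (use e S in \<open>auto simp: L'\<close>)
  then have "contractible S"
    unfolding contractible_def by blast
  then show False
    by (simp add: S_def contractible_sphere)
qed

section \<open>Unitary matrices\<close>

definition hinner :: "complex ^ 'n \<Rightarrow> complex ^ 'n \<Rightarrow> complex" where
  "hinner u v = (\<Sum>i\<in>UNIV. cnj (u $ i) * v $ i)"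

lemma inner_eq_Re_hinner: "u \<bullet> v = Re (hinner u v)"
  by (simp add: inner_vec_def hinner_def inner_complex_def)

lemma hinner_self: "hinner u u = complex_of_real ((norm u)\<^sup>2)"
proof (rule complex_eqI)
  show "Re (hinner u u) = Re (complex_of_real ((norm u)\<^sup>2))"
    by (simp only: inner_eq_Re_hinner[symmetric]) (simp add: power2_norm_eq_inner)
qed (simp add: hinner_def complex_mult_cnj mult.commute)

lemma hinner_scale: "hinner (c *s u) (d *s v) = cnj c * d * hinner u v"
  by (simp add: hinner_def sum_distrib_left mult_ac)

lemma hinner_matrix_left: "hinner (A *v u) v = hinner u (conj_transpose A *v v)"
proof -
  have "hinner (A *v u) v = (\<Sum>i\<in>UNIV. \<Sum>j\<in>UNIV. cnj (A $ i $ j) * cnj (u $ j) * v $ i)"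
    by (simp add: hinner_def matrix_vector_mult_def sum_distrib_right)
  also have "\<dots> = (\<Sum>j\<in>UNIV. \<Sum>i\<in>UNIV. cnj (A $ i $ j) * cnj (u $ j) * v $ i)"
    by (rule sum.swap)
  also have "\<dots> = hinner u (conj_transpose A *v v)"
    by (simp add: hinner_def matrix_vector_mult_def conj_transpose_def sum_distrib_left mult_ac)
  finally show ?thesis .
qed

lemma unitary_group_iff:
  "A \<in> unitary_group \<longleftrightarrow> conj_transpose A ** A = mat 1"
  using matrix_left_right_inverse[of A "conj_transpose A"] by (auto simp: unitary_group_def)

lemma hinner_unitary: "A \<in> unitary_group \<Longrightarrow> hinner (A *v u) (A *v v) = hinner u v"
  by (simp add: hinner_matrix_left matrix_vector_mul_assoc unitary_group_iff)

lemma norm_unitary [simp]: "A \<in> unitary_group \<Longrightarrow> norm (A *v u) = norm u"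
  using inner_eq_Re_hinner[of u u] inner_eq_Re_hinner[of "A *v u" "A *v u"]
  by (simp add: hinner_unitary norm_eq_sqrt_inner)

lemma norm_vector_scalar_mult: "norm (c *s u) = norm c * norm (u :: complex ^ 'n)"
  by (simp add: norm_vec_def norm_mult L2_set_right_distrib)

text \<open>Polarisation: norms determine the real inner product, and a vector \<open>D *v v\<close>
  is 0 as soon as the real part of its Hermitian product with every \<open>u\<close>
  vanishes.\<close>

lemma unitaryI_norm:
  assumes "\<And>u. norm (A *v u) = norm u"
  shows "A \<in> unitary_group"
proof -
  define D where "D = conj_transpose A ** A - mat 1"
  have polar: "(A *v u) \<bullet> (A *v v) = u \<bullet> v" for u v
    using assms[of u] assms[of v] assms[of "u + v"]
      dot_norm[of u v] dot_norm[of "A *v u" "A *v v"]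
    by (simp add: matrix_vector_right_distrib)
  have "Re (hinner u (D *v v)) = 0" for u v
    using polar[of u v]
    by (simp add: D_def inner_eq_Re_hinner hinner_matrix_left matrix_vector_mul_assoc
      matrix_vector_mult_diff_rdistrib) (simp add: hinner_def algebra_simps sum_subtractf)
  then have "D *v v = 0" for v
    by (metis inner_eq_Re_hinner inner_eq_zero_iff)
  then have "D = 0"
    by (metis matrix_eq matrix_vector_mult_0)
  then show ?thesis
    by (simp add: D_def unitary_group_iff)
qed

lemma norm_matrix_vector_mult_le:
  fixes A :: "complex ^ 'n ^ 'm"
  shows "norm (A *v u) \<le> norm A * norm u"
proof -
  have "norm ((A *v u) $ i) \<le> norm (A $ i) * norm u" for i
  proof -
    have "norm ((A *v u) $ i) \<le> (\<Sum>j\<in>UNIV. norm (A $ i $ j) * norm (u $ j))"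
      unfolding matrix_vector_mult_def by (auto intro: sum_norm_le simp: norm_mult)
    also have "\<dots> \<le> norm (A $ i) * norm u"
      unfolding norm_vec_def using L2_set_mult_ineq[of "\<lambda>j. norm (A $ i $ j)" "\<lambda>j. norm (u $ j)"]
      by simp
    finally show ?thesis .
  qed
  then have "L2_set (\<lambda>i. norm ((A *v u) $ i)) UNIV \<le> L2_set (\<lambda>i. norm (A $ i) * norm u) UNIV"
    by (intro L2_set_mono) auto
  then show ?thesis
    by (simp add: norm_vec_def L2_set_left_distrib)
qed

section \<open>Eigenvalues of unitary matrices and compactness of the group\<close>

definition eigenvalues :: "complex ^ 'n ^ 'n \<Rightarrow> complex set" where
  "eigenvalues A = {\<nu>. \<exists>u. u \<noteq> 0 \<and> A *v u = \<nu> *s u}"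

text \<open>Applying \<open>A\<close> to both vectors preserves \<open>hinner u v\<close> but also
  multiplies it by \<open>cnj \<nu> * \<mu>\<close>, which differs from 1.\<close>

lemma hinner_eigenvectors_unitary:
  assumes A: "A \<in> unitary_group" and u: "A *v u = \<nu> *s u" and v: "A *v v = \<mu> *s v"
    and "norm \<nu> = 1" "\<nu> \<noteq> \<mu>"
  shows "hinner u v = 0"
proof -
  have "hinner u v = cnj \<nu> * \<mu> * hinner u v"
    using hinner_unitary[OF A, of u v] by (simp add: u v hinner_scale)
  moreover have "cnj \<nu> * \<mu> \<noteq> 1"
  proof
    assume "cnj \<nu> * \<mu> = 1"
    then have "\<nu> * cnj \<nu> * \<mu> = \<nu>" by (simp add: mult.assoc)
    then show False using assms by (simp add: complex_mult_cnj cmod_power2[symmetric])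
  qed
  ultimately show ?thesis by (metis mult_cancel_right1)
qed

lemma norm_eigenvalue_unitary:
  assumes "A \<in> unitary_group" "\<nu> \<in> eigenvalues A"
  shows "norm \<nu> = 1"
proof -
  obtain u where "u \<noteq> 0" "A *v u = \<nu> *s u" using assms by (auto simp: eigenvalues_def)
  then show ?thesis using norm_unitary[OF assms(1), of u] by (simp add: norm_vector_scalar_mult)
qed

text \<open>A dimension count over the reals: eigenvectors \<open>v\<close> for different
  eigenvalues, together with their multiples by \<open>\<i>\<close>, are pairwise orthogonal, and
  the real dimension of the space is \<open>2 * CARD('n)\<close>.\<close>

lemma
  fixes A :: "complex ^ 'n ^ 'n"
  assumes A: "A \<in> unitary_group"
  shows finite_eigenvalues_unitary: "finite (eigenvalues A)"
    and card_eigenvalues_unitary: "card (eigenvalues A) \<le> CARD('n)"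
proof -
  \<comment> \<open>Finite subsets come first, since finiteness of the whole set is itself a
    consequence of this bound.\<close>
  have *: "finite F \<and> card F \<le> CARD('n)" if "F \<subseteq> eigenvalues A" "finite F" for F
  proof -
    have "\<forall>\<nu>\<in>F. \<exists>u. u \<noteq> 0 \<and> A *v u = \<nu> *s u"
      using that by (auto simp: eigenvalues_def)
    then obtain v where v: "\<And>\<nu>. \<nu> \<in> F \<Longrightarrow> v \<nu> \<noteq> 0" "\<And>\<nu>. \<nu> \<in> F \<Longrightarrow> A *v v \<nu> = \<nu> *s v \<nu>"
      by metis
    define g where "g = (\<lambda>(c::complex, \<nu>). c *s v \<nu>)"
    have orth: "g (c, \<nu>) \<bullet> g (d, \<mu>) = 0"
      if "\<nu> \<in> F" "\<mu> \<in> F" "c \<in> {1, \<i>}" "d \<in> {1, \<i>}" "(c, \<nu>) \<noteq> (d, \<mu>)" for c d \<nu> \<mu>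
    proof (cases "\<nu> = \<mu>")
      case True
      then show ?thesis using that
        by (auto simp: g_def inner_eq_Re_hinner hinner_scale hinner_self)
    next
      case False
      then have "hinner (v \<nu>) (v \<mu>) = 0"
        using hinner_eigenvectors_unitary[OF A v(2) v(2)] norm_eigenvalue_unitary[OF A] that \<open>F \<subseteq> _\<close>
        by blast
      then show ?thesis by (simp add: g_def inner_eq_Re_hinner hinner_scale)
    qed
    have g0: "g (c, \<nu>) \<noteq> 0" if "\<nu> \<in> F" "c \<in> {1, \<i>}" for c \<nu>
      using that v(1)[of \<nu>] by (auto simp: g_def)
    have inj: "inj_on g ({1, \<i>} \<times> F)"
    proof (rule inj_onI, rule ccontr)
      fix x y assume "x \<in> {1, \<i>} \<times> F" "y \<in> {1, \<i>} \<times> F" "g x = g y" "x \<noteq> y"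
      then have "g x \<bullet> g x = 0"
        using orth[of "snd x" "snd y" "fst x" "fst y"] by auto
      then show False using g0[of "snd x" "fst x"] \<open>x \<in> _\<close> by auto
    qed
    have "pairwise orthogonal (g ` ({1, \<i>} \<times> F))"
      unfolding pairwise_def orthogonal_def
    proof (intro ballI impI)
      fix x y assume "x \<in> g ` ({1, \<i>} \<times> F)" "y \<in> g ` ({1, \<i>} \<times> F)" "x \<noteq> y"
      then obtain c d \<mu> \<nu> where "x = g (c, \<mu>)" "y = g (d, \<nu>)" "c \<in> {1, \<i>}" "d \<in> {1, \<i>}" "\<mu> \<in> F" "\<nu> \<in> F"
        by blast
      with \<open>x \<noteq> y\<close> show "x \<bullet> y = 0"
        using orth[of \<mu> \<nu> c d] by blast
    qed
    moreover have "0 \<notin> g ` ({1, \<i>} \<times> F)"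
    proof
      assume "0 \<in> g ` ({1, \<i>} \<times> F)"
      then obtain c \<mu> where "0 = g (c, \<mu>)" "c \<in> {1, \<i>}" "\<mu> \<in> F" by blast
      then show False using g0[of \<mu> c] by metis
    qed
    ultimately have "independent (g ` ({1, \<i>} \<times> F))"
      by (rule pairwise_orthogonal_independent)
    then have "card (g ` ({1, \<i>} \<times> F)) \<le> DIM(complex ^ 'n)"
      using independent_bound by blast
    then have "2 * card F \<le> 2 * CARD('n)"
      using inj by (simp add: card_image card_cartesian_product)
    then show ?thesis using \<open>finite F\<close> by simp
  qed
  show "finite (eigenvalues A)"
  proof (rule ccontr)
    assume "\<not> ?thesis"
    then obtain F where "F \<subseteq> eigenvalues A" "finite F" "card F = Suc CARD('n)"
      using infinite_arbitrarily_large by blast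
    then show False using *[of F] by simp
  qed
  then show "card (eigenvalues A) \<le> CARD('n)"
    using * by blast
qed

lemma norm_vec_le_card:
  fixes x :: "'a::real_normed_vector ^ 'n"
  assumes "\<And>i. norm (x $ i) \<le> c"
  shows "norm x \<le> real CARD('n) * c"
proof -
  have "norm x \<le> (\<Sum>i\<in>UNIV. norm (x $ i))"
    unfolding norm_vec_def by (intro L2_set_le_sum) auto
  also have "\<dots> \<le> real CARD('n) * c"
    using sum_mono[of UNIV "\<lambda>i. norm (x $ i)" "\<lambda>_. c"] assms by simp
  finally show ?thesis by simp
qed

lemma compact_unitary_group: "compact (unitary_group :: (complex ^ 'n ^ 'n) set)"
proof -
  have "norm (A $ i $ j) \<le> 1" if "A \<in> unitary_group" for A :: "complex ^ 'n ^ 'n" and i j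
  proof -
    have "norm (A $ i $ j) \<le> norm (A *v axis j 1)"
      using Finite_Cartesian_Product.norm_nth_le[of "A *v axis j 1" i] 
      by (simp add: matrix_vector_mult_def axis_def if_distrib[where f = "times _"] cong: if_cong)
    then show ?thesis using that by simp
  qed
  then have "norm A \<le> real CARD('n) * (real CARD('n) * 1)" if "A \<in> unitary_group" for A :: "complex ^ 'n ^ 'n"
    by (intro norm_vec_le_card) (simp add: that)
  then have "bounded (unitary_group :: (complex ^ 'n ^ 'n) set)"
    unfolding bounded_iff by blast
  moreover have "closed (unitary_group :: (complex ^ 'n ^ 'n) set)"
    unfolding unitary_group_def conj_transpose_def matrix_matrix_mult_def
    by (intro closed_Collect_conj closed_Collect_eq continuous_intros)
  ultimately show ?thesis by (simp add: compact_eq_bounded_closed)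
qed

section \<open>The upper bound\<close>

lemma mat_mult_vector:
  fixes u :: "complex ^ 'n"
  shows "mat c *v u = c *s u"
  by (simp add: vec_eq_iff matrix_vector_mult_def mat_def if_distrib[where f = "\<lambda>x. x * _"] cong: if_cong)

text \<open>Serves to show that avoiding an eigenvalue is an open condition.\<close>

lemma eigenvalue_iff_det:
  fixes A :: "complex ^ 'n ^ 'n"
  shows "\<nu> \<in> eigenvalues A \<longleftrightarrow> det (A - mat \<nu>) = 0"
proof -
  have "(A - mat \<nu>) *v u = 0 \<longleftrightarrow> A *v u = \<nu> *s u" for u
    by (simp add: matrix_vector_mult_diff_rdistrib mat_mult_vector)
  then have "\<nu> \<in> eigenvalues A \<longleftrightarrow> \<not> (\<forall>u. (A - mat \<nu>) *v u = 0 \<longrightarrow> u = 0)"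
    by (auto simp: eigenvalues_def)
  then show ?thesis
    by (metis invertible_det_nz invertible_left_inverse matrix_left_invertible_ker)
qed

lemma continuous_on_matrix_mult_complex [continuous_intros]:
  fixes f :: "'a::topological_space \<Rightarrow> complex ^ 'n ^ 'm" and g :: "'a \<Rightarrow> complex ^ 'k ^ 'n"
  shows "continuous_on S f \<Longrightarrow> continuous_on S g \<Longrightarrow> continuous_on S (\<lambda>x. f x ** g x)"
  unfolding matrix_matrix_mult_def by (intro continuous_intros)

lemma continuous_on_mat_complex [continuous_intros]:
  fixes f :: "'a::topological_space \<Rightarrow> complex"
  shows "continuous_on S f \<Longrightarrow> continuous_on S (\<lambda>x. mat (f x) :: complex ^ 'n ^ 'n)"
  unfolding mat_def
proof (intro continuous_on_vec_lambda)
  fix i j :: 'n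
  assume "continuous_on S f"
  then show "continuous_on S (\<lambda>x. if i = j then f x else 0)"
    by (cases "i = j") auto
qed

text \<open>The homotopy scales to the origin in the Cayley chart around \<open>-\<nu>\<close>.\<close>

lemma categorical_avoiding_eigenvalue:
  fixes \<nu> :: complex
  assumes \<nu>: "norm \<nu> = 1"
  shows "categorical (top_of_set (unitary_group :: (complex ^ 'n ^ 'n) set))
    {A \<in> unitary_group. \<nu> \<notin> eigenvalues A}"
proof -
  let ?G = "unitary_group :: (complex ^ 'n ^ 'n) set"
  let ?U = "{A \<in> ?G. \<nu> \<notin> eigenvalues A}"
  have "continuous_on UNIV (\<lambda>A::complex ^ 'n ^ 'n. det (A - mat \<nu>))"
    unfolding det_def by (intro continuous_intros)
  then have "open {A :: complex ^ 'n ^ 'n. det (A - mat \<nu>) \<noteq> 0}"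
    by (intro open_Collect_neq continuous_intros)
  then have "openin (top_of_set ?G) (?G \<inter> {A. det (A - mat \<nu>) \<noteq> 0})"
    by (simp add: openin_open_Int)
  then have opn: "openin (top_of_set ?G) ?U"
    by (simp add: eigenvalue_iff_det Collect_conj_eq)

  \<comment> \<open>Put \<open>B = - cnj \<nu> A\<close> and let \<open>X\<close> be the Cayley
    transform of \<open>B\<close>, the quotient of \<open>B - 1\<close> by \<open>B + 1\<close>.
    Replacing \<open>X\<close> by \<open>(1 - t) X\<close> replaces \<open>B\<close> by the quotient
    of \<open>(2 - t) B + t\<close> by \<open>(2 - t) + t B\<close>. \<open>Q\<close> is this
    denominator, and \<open>P\<close> is the numerator multiplied by \<open>- \<nu>\<close>.\<close>
  define Q P :: "real \<times> (complex ^ 'n ^ 'n) \<Rightarrow> complex ^ 'n ^ 'n" where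
    "Q = (\<lambda>z. mat (of_real (2 - fst z)) - mat (of_real (fst z) * cnj \<nu>) ** snd z)" and
    "P = (\<lambda>z. mat (of_real (2 - fst z)) ** snd z - mat (of_real (fst z) * \<nu>))"
  define k where "k = (\<lambda>z. P z ** matrix_inv (Q z))"
  have Qv: "Q (t, A) *v u = of_real (2 - t) *s u - (of_real t * cnj \<nu>) *s (A *v u)" for t A u
    by (simp add: Q_def matrix_vector_mult_diff_rdistrib mat_mult_vector flip: matrix_vector_mul_assoc)
  have Pv: "P (t, A) *v u = of_real (2 - t) *s (A *v u) - (of_real t * \<nu>) *s u" for t A u
    by (simp add: P_def matrix_vector_mult_diff_rdistrib mat_mult_vector flip: matrix_vector_mul_assoc)
  have \<nu>\<nu>: "\<nu> * cnj \<nu> = 1" "cnj \<nu> * \<nu> = 1"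
    using \<nu> by (simp_all add: complex_mult_cnj cmod_power2[symmetric] mult.commute)
  \<comment> \<open>Equality of these norms makes \<open>k\<close> norm-preserving, hence
    unitary-valued.\<close>
  have norm_PQ: "norm (P (t, A) *v u) = norm (Q (t, A) *v u)" if "A \<in> ?G" for t A u
  proof -
    have "(norm (P (t, A) *v u))\<^sup>2 = (norm (of_real (2 - t) *s (A *v u)))\<^sup>2 + (norm ((of_real t * \<nu>) *s u))\<^sup>2
        - 2 * ((of_real (2 - t) *s (A *v u)) \<bullet> ((of_real t * \<nu>) *s u))"
      by (simp add: Pv power2_norm_eq_inner inner_diff inner_commute del: of_real_diff)
    moreover have "(norm (Q (t, A) *v u))\<^sup>2 = (norm (of_real (2 - t) *s u))\<^sup>2 + (norm ((of_real t * cnj \<nu>) *s (A *v u)))\<^sup>2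
        - 2 * (((of_real t * cnj \<nu>) *s (A *v u)) \<bullet> (of_real (2 - t) *s u))"
      by (simp add: Qv power2_norm_eq_inner inner_diff inner_commute del: of_real_diff)
    ultimately have "(norm (P (t, A) *v u))\<^sup>2 = (norm (Q (t, A) *v u))\<^sup>2"
      using that \<nu> by (simp add: norm_vector_scalar_mult inner_eq_Re_hinner hinner_scale norm_mult mult_ac del: of_real_diff)
    then show ?thesis by simp
  qed
  \<comment> \<open>For a kernel vector a comparison of norms gives \<open>2 - t = t\<close>; at
    \<open>t = 1\<close> it is an eigenvector of \<open>A\<close> for \<open>\<nu>\<close>.\<close>
  have inv: "invertible (Q (t, A))" if t: "t \<in> {0..1}" and A: "A \<in> ?U" for t A
  proof -
    have "u = 0" if u: "Q (t, A) *v u = 0" for u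
    proof (rule ccontr)
      assume "u \<noteq> 0"
      have eq: "of_real (2 - t) *s u = (of_real t * cnj \<nu>) *s (A *v u)"
        using u by (simp add: Qv)
      then have "norm (complex_of_real (2 - t)) * norm u = norm (of_real t * cnj \<nu>) * norm u"
        using A norm_vector_scalar_mult[of _ u] norm_vector_scalar_mult[of _ "A *v u"] by (metis (mono_tags, lifting) mem_Collect_eq norm_unitary)
      then have "t = 1"
        using \<open>u \<noteq> 0\<close> t \<nu> by (simp add: norm_mult del: of_real_diff)
      then have "u = cnj \<nu> *s (A *v u)"
        using eq by simp
      then have "\<nu> *s u = (\<nu> * cnj \<nu>) *s (A *v u)"
        by (metis vector_smult_assoc)
      then have "\<nu> *s u = A *v u"
        by (simp add: \<nu>\<nu>)
      then show False
        using A \<open>u \<noteq> 0\<close> by (auto simp: eigenvalues_def)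
    qed
    then show ?thesis
      by (simp add: invertible_left_inverse matrix_left_invertible_ker)
  qed
  have inv': "matrix_inv (Q z) ** Q z = mat 1" "Q z ** matrix_inv (Q z) = mat 1" if "z \<in> {0..1} \<times> ?U" for z
    using someI_ex[OF inv[unfolded invertible_def], of "fst z" "snd z"] that
    by (auto simp: matrix_inv_def)
  have kG: "k z \<in> ?G" if z: "z \<in> {0..1} \<times> ?U" for z
  proof (rule unitaryI_norm)
    obtain t A where [simp]: "z = (t, A)" and A: "A \<in> ?G" using z by auto
    fix u
    have "norm (k z *v u) = norm (Q z *v (matrix_inv (Q z) *v u))"
      by (simp add: k_def norm_PQ[OF A] flip: matrix_vector_mul_assoc)
    then show "norm (k z *v u) = norm u"
      using inv'[OF z] by (simp add: matrix_vector_mul_assoc)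
  qed
  have kQ: "Y = k z \<longleftrightarrow> Y ** Q z = P z" if "z \<in> {0..1} \<times> ?U" for z Y
    using inv'[OF that] by (metis k_def matrix_mul_assoc matrix_mul_rid)
  have contPQ: "continuous_on UNIV P" "continuous_on UNIV Q"
    unfolding P_def Q_def by (intro continuous_intros)+
  \<comment> \<open>The graph is cut out by the polynomial equation \<open>Y Q = P\<close>, so it is
    closed; as the target is compact, \<open>k\<close> is continuous, with no estimate on matrix
    inverses.\<close>
  have graph: "(\<lambda>z. (z, k z)) ` ({0..1} \<times> ?U) =
      (({0..1} \<times> ?U) \<times> ?G) \<inter> (\<lambda>y. snd y ** Q (fst y) - P (fst y)) -` {0}"
  proof (intro set_eqI iffI)
    fix y assume "y \<in> (\<lambda>z. (z, k z)) ` ({0..1} \<times> ?U)"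
    then obtain z where "z \<in> {0..1} \<times> ?U" "y = (z, k z)" by blast
    then show "y \<in> (({0..1} \<times> ?U) \<times> ?G) \<inter> (\<lambda>y. snd y ** Q (fst y) - P (fst y)) -` {0}"
      using kG[of z] kQ[of z "k z"] by simp
  next
    fix y assume "y \<in> (({0..1} \<times> ?U) \<times> ?G) \<inter> (\<lambda>y. snd y ** Q (fst y) - P (fst y)) -` {0}"
    then show "y \<in> (\<lambda>z. (z, k z)) ` ({0..1} \<times> ?U)"
      using kQ[of "fst y" "snd y"] by (intro image_eqI[of _ _ "fst y"]) (auto simp: prod_eq_iff)
  qed
  have "continuous_on ({0..1} \<times> ?U) k"
  proof (subst continuous_closed_graph_eq[OF compact_unitary_group])
    show "k \<in> {0..1} \<times> ?U \<rightarrow> ?G" using kG by blast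
    show "closedin (top_of_set (({0..1} \<times> ?U) \<times> ?G)) ((\<lambda>z. (z, k z)) ` ({0..1} \<times> ?U))"
      unfolding graph
      by (intro continuous_closedin_preimage continuous_intros
        continuous_on_compose2[OF contPQ(1)] continuous_on_compose2[OF contPQ(2)]) auto
  qed
  then have "homotopic_with_canon (\<lambda>_. True) ?U ?G id (\<lambda>_. mat (- \<nu>))"
  proof (rule homotopic_with_canonI)
    show "k ` ({0..1} \<times> ?U) \<subseteq> ?G" using kG by blast
    show "k (0, A) = id A" if "A \<in> ?U" for A
    proof (rule sym, subst kQ)
      have "A ** mat 2 = mat 2 ** A" by (simp add: matrix_eq mat_mult_vector vector_scalar_commute flip: matrix_vector_mul_assoc)
      then show "id A ** Q (0, A) = P (0, A)" 
        by (simp add: P_def Q_def)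
    qed (use that in auto)
    show "k (1, A) = mat (- \<nu>)" if "A \<in> ?U" for A
      by (rule sym, subst kQ)
        (use that \<nu>\<nu> in \<open>auto simp: matrix_eq Pv Qv mat_mult_vector vector_smult_assoc vector_ssub_ldistrib simp flip: matrix_vector_mul_assoc\<close>)
  qed
  moreover have "subtopology (top_of_set ?G) ?U = top_of_set ?U"
    by (simp add: subtopology_subtopology Int_absorb1)
  ultimately show ?thesis
    unfolding categorical_def using opn by auto
qed

lemma infinite_unit_circle: "infinite (sphere (0::complex) 1)"
proof
  assume fin: "finite (sphere (0::complex) 1)"
  have "connected (sphere (0::complex) 1)"
    by (rule connected_sphere) simp
  then have "sphere (0::complex) 1 = {} \<or> (\<exists>a. sphere (0::complex) 1 = {a})"
    using fin connected_finite_iff_sing by blast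
  moreover have "1 \<in> sphere (0::complex) 1" "- 1 \<in> sphere (0::complex) 1"
    by simp_all
  ultimately have "(1::complex) = - 1"
    by (metis empty_iff singletonD)
  then show False by simp
qed

lemma LS_cat_unitary_group_le:
  "LS_cat (top_of_set (unitary_group :: (complex ^ 'n ^ 'n) set)) \<le> enat CARD('n)"
proof -
  let ?G = "unitary_group :: (complex ^ 'n ^ 'n) set"
  define V where "V = (\<lambda>\<nu>. {A \<in> ?G. \<nu> \<notin> eigenvalues A})"
  obtain F where F: "F \<subseteq> sphere (0::complex) 1" "finite F" "card F = Suc CARD('n)"
    using infinite_arbitrarily_large[OF infinite_unit_circle] by blast
  have "\<exists>\<nu>\<in>F. A \<in> V \<nu>" if A: "A \<in> ?G" for A
  proof (rule ccontr)
    assume "\<not> ?thesis"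
    then have "F \<subseteq> eigenvalues A" using A by (auto simp: V_def)
    then show False
      using card_mono[OF finite_eigenvalues_unitary[OF A], of F] card_eigenvalues_unitary[OF A] F(3) by linarith
  qed
  then have "\<Union> (V ` F) = ?G" by (auto simp: V_def)
  moreover have "categorical (top_of_set ?G) (V \<nu>)" if "\<nu> \<in> F" for \<nu>
    unfolding V_def using that F(1) by (intro categorical_avoiding_eigenvalue) auto
  ultimately have "(INF \<U> \<in> {\<U>. finite \<U> \<and> (\<forall>U\<in>\<U>. categorical (top_of_set ?G) U) \<and>
      \<Union>\<U> = topspace (top_of_set ?G)}. enat (card \<U>)) \<le> enat (card (V ` F))"
    using F(2) by (intro INF_lower) auto
  also have "\<dots> \<le> enat (Suc CARD('n))"
    using card_image_le[OF F(2), of V] F(3) by simp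
  finally have "(INF \<U> \<in> {\<U>. finite \<U> \<and> (\<forall>U\<in>\<U>. categorical (top_of_set ?G) U) \<and>
      \<Union>\<U> = topspace (top_of_set ?G)}. enat (card \<U>)) \<le> enat (Suc CARD('n))" .
  moreover have "x - 1 \<le> enat m" if "x \<le> enat (Suc m)" for x m
    using that by (cases x) (auto simp: one_enat_def)
  ultimately show ?thesis
    unfolding LS_cat_def by blast
qed

section \<open>The system of eigenvector equations\<close>

lemma has_derivative_vec_lambda [derivative_intros]:
  fixes f :: "'a::real_normed_vector \<Rightarrow> 'n::finite \<Rightarrow> 'b::euclidean_space"
  assumes "\<And>i. ((\<lambda>x. f x i) has_derivative (\<lambda>x. f' x i)) (at x within S)"
  shows "((\<lambda>x. \<chi> i. f x i) has_derivative (\<lambda>x. \<chi> i. f' x i)) (at x within S)"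
  unfolding has_derivative_componentwise_within[of "\<lambda>x. \<chi> i. f x i"]
  using assms by (auto simp: Basis_vec_def inner_axis intro!: has_derivative_inner_left)

lemma has_derivative_vec_nth [derivative_intros]:
  "(f has_derivative f') F \<Longrightarrow> ((\<lambda>x. f x $ i) has_derivative (\<lambda>x. f' x $ i)) F"
  by (rule bounded_linear.has_derivative[OF bounded_linear_vec_nth])

lemma continuous_on_matrix_vector_mult_complex [continuous_intros]:
  fixes f :: "'a::topological_space \<Rightarrow> complex ^ 'n ^ 'm" and g :: "'a \<Rightarrow> complex ^ 'n"
  shows "continuous_on S f \<Longrightarrow> continuous_on S g \<Longrightarrow> continuous_on S (\<lambda>x. f x *v g x)"
  unfolding matrix_vector_mult_def by (intro continuous_intros)

lemma continuous_on_vector_scalar_mult_complex [continuous_intros]: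
  fixes g :: "'a::topological_space \<Rightarrow> complex ^ 'n"
  shows "continuous_on S f \<Longrightarrow> continuous_on S g \<Longrightarrow> continuous_on S (\<lambda>x. f x *s g x)"
  unfolding vector_scalar_mult_def by (intro continuous_intros)

text \<open>On Hermitian matrices \<open>pack\<close> is a linear isomorphism onto the real matrices, so that \<open>A\<^sup>* A = 1\<close> becomes a system
  of exactly \<open>n\<^sup>2\<close> real equations.\<close>

definition pack :: "complex ^ 'n ^ 'n \<Rightarrow> real ^ 'n ^ 'n" where
  "pack Z = (\<chi> a b. Re (Z $ a $ b) + Im (Z $ a $ b))"

lemma pack_nth: "pack Z $ a $ b = Re (Z $ a $ b) + Im (Z $ a $ b)"
  by (simp add: pack_def)

text \<open>For Hermitian \<open>Z\<close> the entries of \<open>pack Z\<close> at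
  \<open>(a, b)\<close> and \<open>(b, a)\<close> are the sum and the difference of the real and
  imaginary part of one complex number.\<close>

lemma pack_eq_0_hermitian:
  assumes "conj_transpose Z = Z" "pack Z = 0"
  shows "Z = 0"
proof -
  have "Z $ a $ b = 0" for a b
  proof -
    have "Z $ a $ b = cnj (Z $ b $ a)"
      using arg_cong[OF assms(1), of "\<lambda>Z. Z $ a $ b"] by (simp add: conj_transpose_def)
    moreover have "pack Z $ a $ b = 0" "pack Z $ b $ a = 0"
      using assms(2) by simp_all
    ultimately have "Re (Z $ a $ b) = 0 \<and> Im (Z $ a $ b) = 0"
      unfolding pack_nth complex_eq_iff by simp
    then show ?thesis
      by (simp add: complex_eq_iff)
  qed
  then show ?thesis by (simp add: vec_eq_iff)
qed

abbreviation defect :: "complex ^ 'n ^ 'n \<Rightarrow> real ^ 'n ^ 'n" where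
  "defect A \<equiv> pack (conj_transpose A ** A - mat 1)"

lemma defect_eq_0_iff: "defect A = 0 \<longleftrightarrow> A \<in> unitary_group"
proof
  have "conj_transpose (conj_transpose A ** A - mat 1) = conj_transpose A ** A - mat 1"
    by (simp add: vec_eq_iff conj_transpose_def matrix_matrix_mult_def mat_def mult.commute)
  then show "A \<in> unitary_group" if "defect A = 0"
    using pack_eq_0_hermitian[OF _ that] by (simp add: unitary_group_iff)
qed (simp add: unitary_group_iff pack_def vec_eq_iff)

text \<open>An arbitrary linear order on the index type.\<close>

definition precedes :: "'n::finite \<Rightarrow> 'n \<Rightarrow> bool" (infix "\<lhd>" 50) where
  "i \<lhd> j \<longleftrightarrow> to_nat i < to_nat j"

lemma precedes_irrefl [simp]: "\<not> i \<lhd> i"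
  by (simp add: precedes_def)

lemma precedes_asym: "i \<lhd> j \<Longrightarrow> \<not> j \<lhd> i"
  by (simp add: precedes_def)

lemma precedes_linear: "i \<noteq> j \<Longrightarrow> \<not> i \<lhd> j \<Longrightarrow> j \<lhd> i"
  by (metis precedes_def linorder_cases to_nat_split)

text \<open>The maps \<open>p i (t, _)\<close> will be smooth approximations of a deformation of the identity of the
  unitary group. They need not be unitary-valued, hence the positive multipliers \<open>q\<close> below.\<close>

locale eigenvector_system =
  fixes p :: "'n::finite \<Rightarrow> real \<times> (complex ^ 'n ^ 'n) \<Rightarrow> complex ^ 'n ^ 'n" and ev :: "'n \<Rightarrow> complex"
  assumes p_0: "\<And>i A. p i (0, A) = A"
    and p_differentiable: "\<And>i x. p i differentiable (at x)"
    and p_nonzero: "\<And>i t A u. \<lbrakk>t \<in> {0..1}; A \<in> unitary_group; u \<noteq> 0\<rbrakk> \<Longrightarrow> p i (t, A) *v u \<noteq> 0"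
    and norm_ev: "\<And>i. norm (ev i) = 1"
    and inj_ev: "inj ev"
begin

lemma continuous_p: "continuous_on S (p i)"
  using p_differentiable differentiable_imp_continuous_within
  by (metis continuous_at_imp_continuous_on)

lemma continuous_on_p [continuous_intros]:
  "continuous_on S f \<Longrightarrow> continuous_on S (\<lambda>x. p i (f x))"
  by (rule continuous_on_compose2[OF continuous_p]) auto

text \<open>The parameter \<open>\<theta>\<close> perturbs the eigenvalues (to matrices) and the equation \<open>A\<^sup>* A = 1\<close>;
  the perturbation is switched on linearly in \<open>t\<close>.\<close>

definition solves where
  "solves \<theta> t A q u \<longleftrightarrow>
    (\<forall>i. p i (t, A) *v (u $ i) = (q $ i :: real) *\<^sub>R (ev i *s (u $ i) + t *\<^sub>R (fst \<theta> $ i *v (u $ i)))) \<and>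
    defect A = t *\<^sub>R snd \<theta> \<and> (\<forall>i b. b \<lhd> i \<longrightarrow> u $ i $ b = 0)"

text \<open>At time 0 the matrix is unitary, so norms force the multipliers to be 1 and the
  \<open>u $ i\<close> are eigenvectors for distinct eigenvalues, hence orthogonal. Starting from
  the last index, each vector is a multiple of a basis vector: the entries before \<open>i\<close>
  vanish by the system, those after \<open>i\<close> by orthogonality to the vectors already
  treated.\<close>

lemma solves_at_0:
  assumes sol: "solves \<theta> 0 A q u" and u: "\<And>i. u $ i \<noteq> 0" and q: "\<And>i. 0 \<le> q $ i"
  shows "A \<in> unitary_group" "q $ i = 1" "A *v (u $ i) = ev i *s (u $ i)" "b \<noteq> i \<Longrightarrow> u $ i $ b = 0"
proof -
  have A: "A \<in> unitary_group"
    using sol by (simp add: solves_def flip: defect_eq_0_iff)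
  have Au: "A *v (u $ i) = q $ i *\<^sub>R (ev i *s (u $ i))" for i
    using sol by (simp add: solves_def p_0)
  have q1: "q $ i = 1" for i
  proof -
    have "norm (u $ i) = \<bar>q $ i\<bar> * norm (u $ i)"
      using norm_unitary[OF A, of "u $ i"] by (simp add: Au norm_vector_scalar_mult norm_ev)
    then show ?thesis using u[of i] q[of i] by simp
  qed
  then have eig: "A *v (u $ i) = ev i *s (u $ i)" for i
    by (simp add: Au)
  have off: "\<forall>b. b \<noteq> i \<longrightarrow> u $ i $ b = 0" for i
  proof (induction "card {l. i \<lhd> l}" arbitrary: i rule: less_induct)
    case less
    have "u $ i $ b = 0" if "i \<lhd> b" for b
    proof -
      have "{l. b \<lhd> l} \<subset> {l. i \<lhd> l}"
        using that by (auto simp: precedes_def)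
      then have b: "\<forall>c. c \<noteq> b \<longrightarrow> u $ b $ c = 0"
        using less[of b] by (simp add: psubset_card_mono)
      have "i \<noteq> b" using that by auto
      then have "hinner (u $ b) (u $ i) = 0"
        using hinner_eigenvectors_unitary[OF A eig eig norm_ev, of b i] inj_ev by (auto simp: inj_def)
      moreover have "hinner (u $ b) (u $ i) = cnj (u $ b $ b) * u $ i $ b"
        unfolding hinner_def using b by (subst sum.remove[of _ b]) (auto intro!: sum.neutral)
      moreover have "u $ b $ b \<noteq> 0"
        using u[of b] b by (auto simp: vec_eq_iff)
      ultimately show ?thesis by simp
    qed
    moreover have "u $ i $ b = 0" if "b \<lhd> i" for b
      using sol that by (simp add: solves_def)
    ultimately show ?case using precedes_linear by blast
  qed
  show "A \<in> unitary_group" "q $ i = 1" "A *v (u $ i) = ev i *s (u $ i)" "b \<noteq> i \<Longrightarrow> u $ i $ b = 0"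
    using A q1 eig off by blast+
qed

end

text \<open>A real matrix \<open>R\<close> encodes the normalised vectors together with the multipliers: entries below
  and above the diagonal are real and imaginary parts of coordinates, and \<open>R $ i $ i\<close> is the
  logarithm of the \<open>i\<close>-th multiplier.\<close>

definition offd :: "real ^ 'n ^ 'n \<Rightarrow> complex ^ 'n ^ 'n" where
  "offd R = (\<chi> i b. if i \<lhd> b then of_real (R $ b $ i) + \<i> * of_real (R $ i $ b) else 0)"

definition chart :: "real ^ 'n ^ 'n \<Rightarrow> complex ^ 'n ^ 'n" where
  "chart R = (\<chi> i. axis i 1 + offd R $ i)"

lemma offd_nth: "offd R $ i $ b = (if i \<lhd> b then of_real (R $ b $ i) + \<i> * of_real (R $ i $ b) else 0)"
  by (simp add: offd_def)

lemma chart_nth: "chart R $ i = axis i 1 + offd R $ i"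
  by (simp add: chart_def)

lemma chart_diag [simp]: "chart R $ i $ i = 1"
  by (simp add: chart_nth offd_nth)

lemma chart_lower: "b \<lhd> i \<Longrightarrow> chart R $ i $ b = 0"
  by (auto simp: chart_nth offd_nth axis_def precedes_asym)

lemma linear_offd: "linear offd"
  by (rule linearI) (simp_all add: vec_eq_iff offd_nth complex_eq_iff)

lemma continuous_on_offd [continuous_intros]:
  "continuous_on S f \<Longrightarrow> continuous_on S (\<lambda>x. offd (f x))"
  by (rule bounded_linear.continuous_on[OF linear_offd[unfolded linear_conv_bounded_linear]])

lemma continuous_on_chart [continuous_intros]:
  "continuous_on S f \<Longrightarrow> continuous_on S (\<lambda>x. chart (f x))"
  unfolding chart_def by (intro continuous_intros)

lemma has_derivative_offd [derivative_intros]: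
  "(f has_derivative f') F \<Longrightarrow> ((\<lambda>x. offd (f x)) has_derivative (\<lambda>x. offd (f' x))) F"
  by (rule bounded_linear.has_derivative[OF linear_offd[unfolded linear_conv_bounded_linear]])

section \<open>Linear and bilinear matrix operations\<close>

lemma bounded_bilinear_matrix_vector_mult:
  "bounded_bilinear ((*v) :: complex ^ 'n ^ 'm \<Rightarrow> _)"
proof
  show "\<exists>K. \<forall>A (u :: complex ^ 'n). norm ((A :: complex ^ 'n ^ 'm) *v u) \<le> norm A * norm u * K"
    by (intro exI[of _ 1]) (simp add: norm_matrix_vector_mult_le)
qed (simp_all add: vec_eq_iff matrix_vector_mult_def algebra_simps sum.distrib scaleR_sum_right)

lemma bounded_bilinear_matrix_matrix_mult:
  "bounded_bilinear ((**) :: complex ^ 'n ^ 'm \<Rightarrow> complex ^ 'k ^ 'n \<Rightarrow> _)"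
  unfolding bilinear_conv_bounded_bilinear[symmetric]
  by (auto simp: bilinear_def intro!: linearI
    simp: vec_eq_iff matrix_matrix_mult_def algebra_simps sum.distrib scaleR_sum_right)

lemma bounded_linear_conj_transpose: "bounded_linear (conj_transpose :: complex ^ 'n ^ 'm \<Rightarrow> _)"
  unfolding linear_conv_bounded_linear[symmetric]
  by (rule linearI) (simp_all add: vec_eq_iff conj_transpose_def)

lemma bounded_linear_pack: "bounded_linear pack"
  unfolding linear_conv_bounded_linear[symmetric]
  by (rule linearI) (simp_all add: vec_eq_iff pack_nth algebra_simps)

lemma bounded_linear_vector_scalar_mult: "bounded_linear ((*s) c :: complex ^ 'n \<Rightarrow> _)"
  unfolding linear_conv_bounded_linear[symmetric]
  by (rule linearI) (simp_all add: vec_eq_iff algebra_simps)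

lemma continuous_on_defect [continuous_intros]:
  "continuous_on S f \<Longrightarrow> continuous_on S (\<lambda>x. defect (f x))"
  by (intro bounded_linear.continuous_on[OF bounded_linear_pack] continuous_intros
    bounded_linear.continuous_on[OF bounded_linear_conj_transpose])

section \<open>The equations in the affine chart and their linearisation at time 0\<close>

context eigenvector_system
begin

text \<open>Unknowns and values lie in the same Euclidean space, as the degree argument demands. The
  triangular shape of the vectors and the positivity of the multipliers are built into
  \<open>chart\<close> and \<open>exp\<close> and need no equations.\<close>

definition residual where
  "residual \<theta> = (\<lambda>(t, A, R).
    ((\<chi> i. p i (t, A) *v (chart R $ i) - exp (R $ i $ i) *\<^sub>R (ev i *s (chart R $ i) + t *\<^sub>R (fst \<theta> $ i *v (chart R $ i)))),
     defect A - t *\<^sub>R snd \<theta>))"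

lemma residual_eq_0_iff:
  "residual \<theta> (t, A, R) = 0 \<longleftrightarrow> solves \<theta> t A (\<chi> i. exp (R $ i $ i)) (chart R)"
  by (simp add: residual_def solves_def zero_prod_def vec_eq_iff[of "vec_lambda _" 0] chart_lower)

lemma continuous_residual: "continuous_on S (residual \<theta>)"
  unfolding residual_def case_prod_beta by (intro continuous_intros)

definition D0 where "D0 = (\<chi> a b. if a = b then ev a else 0)"

lemma D0_mult: "D0 *v u = (\<chi> i. ev i * u $ i)"
  by (simp add: vec_eq_iff D0_def matrix_vector_mult_def if_distrib[where f = "\<lambda>x. x * _"] cong: if_cong)

lemma D0_unitary: "D0 \<in> unitary_group"
proof (rule unitaryI_norm)
  fix u show "norm (D0 *v u) = norm u"
    by (simp add: D0_mult norm_vec_def norm_mult norm_ev)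
qed

lemma offd_eq_0_iff: "(\<forall>i b. offd R $ i $ b = 0) \<and> (\<forall>i. R $ i $ i = 0) \<longleftrightarrow> R = 0"
proof
  assume *: "(\<forall>i b. offd R $ i $ b = 0) \<and> (\<forall>i. R $ i $ i = 0)"
  have "R $ i $ b = 0" for i b
  proof (cases "i = b")
    case False
    then consider "i \<lhd> b" | "b \<lhd> i" using precedes_linear by blast
    then show ?thesis
      using * by cases (metis (no_types) offd_nth complex_eq_iff Re_complex_of_real Im_complex_of_real
        complex_i_mult_minus Complex_eq complex.sel zero_complex.sel)+
  qed (use * in auto)
  then show "R = 0" by (simp add: vec_eq_iff)
qed (simp add: offd_nth)

text \<open>By \<open>solves_at_0\<close> the chart vectors are the basis vectors and the
  multipliers are 1, which gives \<open>R = 0\<close> and prescribes every column of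
  \<open>A\<close>.\<close>

lemma residual_0_zero: "residual \<theta> (0, x) = 0 \<longleftrightarrow> x = (D0, 0)"
proof
  obtain A R where x: "x = (A, R)" by fastforce
  assume "residual \<theta> (0, x) = 0"
  then have sol: "solves \<theta> 0 A (\<chi> i. exp (R $ i $ i)) (chart R)"
    by (simp add: x residual_eq_0_iff)
  have ne: "chart R $ i \<noteq> 0" for i
    using chart_diag[of R i] by (metis zero_index zero_neq_one)
  note * = solves_at_0[OF sol ne, simplified]
  have off: "chart R $ i $ b = 0" if "b \<noteq> i" for i b using *(4)[OF that] .
  have "offd R $ i $ b = 0" for i b
    using off[of b i] by (cases "b = i") (auto simp: chart_nth axis_def offd_nth)
  then have R: "R = 0"
    using *(2) by (simp flip: offd_eq_0_iff)
  have "chart R $ i = axis i 1" for i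
    using off by (simp add: vec_eq_iff axis_def)
  then have "A *v axis i 1 = ev i *s axis i 1" for i
    using *(3)[of i] by simp
  then have "(A *v axis i 1) $ a = (ev i *s axis i 1) $ a" for i a
    by simp
  then have "A $ a $ i = D0 $ a $ i" for a i
    by (simp add: matrix_vector_mult_def axis_def D0_def if_distrib[where f = "times _"] cong: if_cong)
  then show "x = (D0, 0)"
    by (simp add: x R vec_eq_iff)
next
  assume x: "x = (D0, 0)"
  have "defect D0 = 0" using D0_unitary by (simp only: defect_eq_0_iff)
  moreover have "chart 0 $ i $ a = (if a = i then 1 else 0)" for i a :: 'n
    by (simp add: chart_nth offd_nth axis_def)
  ultimately show "residual \<theta> (0, x) = 0"
    by (auto simp: x residual_eq_0_iff solves_def p_0 D0_mult vec_eq_iff[of "vec_lambda _"])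
qed

definition L0 where
  "L0 = (\<lambda>(D, W). ((\<chi> i. D *v axis i 1 + D0 *v (offd W $ i) - (W $ i $ i *\<^sub>R (ev i *s axis i 1) + ev i *s (offd W $ i))),
    pack (conj_transpose D0 ** D + conj_transpose D ** D0)))"

lemma has_derivative_residual_0:
  "((\<lambda>x. residual \<theta> (0, x)) has_derivative L0) (at (D0, 0))"
proof -
  have offd0: "offd 0 $ i = 0" for i :: 'n
    by (simp add: offd_nth vec_eq_iff)
  note [derivative_intros] =
    bounded_bilinear.FDERIV[OF bounded_bilinear_matrix_vector_mult]
    bounded_bilinear.FDERIV[OF bounded_bilinear_matrix_matrix_mult]
    bounded_linear.has_derivative[OF bounded_linear_conj_transpose]
    bounded_linear.has_derivative[OF bounded_linear_pack]
    bounded_linear.has_derivative[OF bounded_linear_vector_scalar_mult]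
  have "((\<lambda>x. ((\<chi> i. fst x *v (axis i 1 + offd (snd x) $ i) - exp (snd x $ i $ i) *\<^sub>R (ev i *s (axis i 1 + offd (snd x) $ i))),
     defect (fst x))) has_derivative L0) (at (D0, 0))"
    unfolding L0_def case_prod_beta
    apply (rule derivative_eq_intros refl)+
    apply (simp add: offd0 algebra_simps)
    done
  then show ?thesis
    by (simp add: residual_def p_0 chart_nth case_prod_beta)
qed

text \<open>Transversality at the common point. For a kernel element, the column equations kill
  \<open>D\<close> above the diagonal, and linearised unitarity (\<open>skew\<close>) carries this
  below it. On the diagonal \<open>D\<close> is a real multiple of \<open>ev i\<close>, which
  \<open>skew\<close> forces to be 0. The remaining equations read
  \<open>(ev a - ev i) * offd W $ i $ a = 0\<close>, and the \<open>ev i\<close> are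
  distinct.\<close>

lemma inj_L0: "inj L0"
proof -
  have "linear L0"
    using has_derivative_linear[OF has_derivative_residual_0] .
  moreover have "(D, W) = 0" if L: "L0 (D, W) = 0" for D W
  proof -
    have col: "D $ a $ i + ev a * offd W $ i $ a - (if a = i then W $ i $ i * ev i else 0) - ev i * offd W $ i $ a = 0" for a i
    proof -
      have "(D *v axis i 1 + D0 *v (offd W $ i) - (W $ i $ i *\<^sub>R (ev i *s axis i 1) + ev i *s (offd W $ i))) $ a = 0"
        using L by (simp add: L0_def zero_prod_def vec_eq_iff)
      moreover have "(D *v axis i 1) $ a = D $ a $ i"
        by (simp add: matrix_vector_mult_def axis_def if_distrib[where f = "times _"] cong: if_cong)
      ultimately show ?thesis
        by (auto simp: D0_mult axis_def scaleR_conv_of_real[where 'a = complex] split: if_splits)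
    qed
    define Z where "Z = conj_transpose D0 ** D + conj_transpose D ** D0"
    have Z_nth: "Z $ a $ b = cnj (ev a) * D $ a $ b + cnj (D $ b $ a) * ev b" for a b
      by (simp add: Z_def matrix_matrix_mult_def conj_transpose_def D0_def
        if_distrib[where f = "\<lambda>x. x * _"] if_distrib[where f = "times _"] if_distrib[where f = cnj] cong: if_cong)
    have "Z = 0"
    proof (rule pack_eq_0_hermitian)
      show "conj_transpose Z = Z"
        by (simp add: vec_eq_iff conj_transpose_def Z_nth)
      show "pack Z = 0" using L by (simp add: L0_def Z_def zero_prod_def)
    qed
    then have skew: "cnj (ev a) * D $ a $ b + cnj (D $ b $ a) * ev b = 0" for a b
      by (simp flip: Z_nth)
    have ev0: "ev a \<noteq> 0" for a using norm_ev[of a] by auto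
    have D1: "D $ a $ i = 0" if "a \<lhd> i" for a i
      using col[of a i] that by (auto simp: offd_nth precedes_asym)
    have D2: "D $ a $ i = 0" if "i \<lhd> a" for a i
      using skew[of i a] D1[OF that] ev0 by simp
    have diag: "W $ i $ i = 0" for i
    proof -
      have "D $ i $ i = W $ i $ i * ev i" using col[of i i] by (simp add: offd_nth)
      then have "2 * (W $ i $ i) * (cnj (ev i) * ev i) = 0"
        using skew[of i i] by (simp add: mult_ac)
      then show ?thesis using ev0 by simp
    qed
    have off: "offd W $ i $ a = 0" for i a
    proof (cases "i \<lhd> a")
      case True
      then have "ev a \<noteq> ev i" using inj_ev by (auto simp: inj_eq)
      moreover have "(ev a - ev i) * offd W $ i $ a = 0"
        using col[of a i] D2[OF True] True by (auto simp: algebra_simps)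
      ultimately show ?thesis by simp
    qed (simp add: offd_nth)
    have "W = 0" using diag off by (simp flip: offd_eq_0_iff)
    moreover have "D $ a $ b = 0" for a b
      using D1[of a b] D2[of b a] col[of a b] diag off precedes_linear[of a b] by (cases "a = b") auto
    ultimately show ?thesis by (simp add: vec_eq_iff zero_prod_def)
  qed
  ultimately show ?thesis
    by (auto simp: linear_injective_0)
qed

end

section \<open>Compactness of the solutions and a priori bounds\<close>

context eigenvector_system
begin

text \<open>Here the multipliers are only required to be nonnegative, which makes the set compact.\<close>

definition solution_set where
  "solution_set = {(\<theta>, t, A, q, u). norm \<theta> \<le> 1 / 2 \<and> t \<in> {0..1} \<and> (\<forall>i. 0 \<le> q $ i) \<and>
     (\<forall>i. norm (u $ i) = 1) \<and> solves \<theta> t A q u}"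

lemma closed_solution_set: "closed solution_set"
proof -
  have "solution_set = {x. norm (fst x) \<le> 1 / 2 \<and> 0 \<le> fst (snd x) \<and> fst (snd x) \<le> 1 \<and>
      (\<forall>i. 0 \<le> fst (snd (snd (snd x))) $ i) \<and> (\<forall>i. norm (snd (snd (snd (snd x))) $ i) = 1) \<and>
      (\<forall>i. p i (fst (snd x), fst (snd (snd x))) *v (snd (snd (snd (snd x))) $ i) =
        (fst (snd (snd (snd x))) $ i) *\<^sub>R (ev i *s (snd (snd (snd (snd x))) $ i) +
          fst (snd x) *\<^sub>R (fst (fst x) $ i *v (snd (snd (snd (snd x))) $ i)))) \<and>
      defect (fst (snd (snd x))) = fst (snd x) *\<^sub>R snd (fst x) \<and>
      (\<forall>i b. b \<lhd> i \<longrightarrow> snd (snd (snd (snd x))) $ i $ b = 0)}"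
    unfolding solution_set_def solves_def by auto
  also have "closed \<dots>"
    by (intro closed_Collect_conj closed_Collect_all closed_Collect_imp closed_Collect_eq
      closed_Collect_le open_Collect_const continuous_intros)
  finally show ?thesis .
qed

text \<open>The diagonal entries of \<open>defect A\<close> are the squared column norms of
  \<open>A\<close> minus 1, so these squares are at most 3/2.\<close>

lemma norm_entry_le_of_defect:
  assumes "defect A = t *\<^sub>R H" "t \<in> {0..1}" "norm H \<le> 1 / 2"
  shows "norm (A $ a $ b) \<le> 2"
proof -
  have "norm (H $ b $ b) \<le> norm H"
    by (meson Finite_Cartesian_Product.norm_nth_le order_trans)
  then have "t * \<bar>H $ b $ b\<bar> \<le> 1 * (1 / 2)"
    using assms(2,3) by (intro mult_mono) auto
  then have H: "t * H $ b $ b \<le> 1 / 2"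
    using assms(2) by (smt (verit) abs_ge_self atLeastAtMost_iff mult_left_mono)
  have "(conj_transpose A ** A - mat 1) $ b $ b = of_real ((\<Sum>l\<in>UNIV. (norm (A $ l $ b))\<^sup>2) - 1)"
    by (simp add: matrix_matrix_mult_def conj_transpose_def mat_def complex_norm_square mult.commute
      flip: of_real_power)
  then have "(\<Sum>l\<in>UNIV. (norm (A $ l $ b))\<^sup>2) - 1 = t * H $ b $ b"
    using arg_cong[OF assms(1), of "\<lambda>Z. Z $ b $ b"] by (simp add: pack_nth)
  moreover have "(norm (A $ a $ b))\<^sup>2 \<le> (\<Sum>l\<in>UNIV. (norm (A $ l $ b))\<^sup>2)"
    by (intro member_le_sum) auto
  ultimately have "(norm (A $ a $ b))\<^sup>2 \<le> 2\<^sup>2"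
    using H by simp
  then show ?thesis by (rule power2_le_imp_le) simp
qed

lemma bounded_solution_set: "bounded solution_set"
proof -
  define N where "N = real CARD('n)"
  have "compact ({0..1::real} \<times> cball (0 :: complex ^ 'n ^ 'n) (N * (N * 2)))"
    by (intro compact_Times) auto
  then have "\<exists>B. \<forall>x\<in>{0..1} \<times> cball 0 (N * (N * 2)). norm (p i x) \<le> B" for i
    using compact_imp_bounded[OF compact_continuous_image[OF continuous_p]] by (fastforce simp: bounded_iff)
  then obtain B where B: "\<And>i x. x \<in> {0..1} \<times> cball 0 (N * (N * 2)) \<Longrightarrow> norm (p i x) \<le> B i"
    by metis
  define K where "K = cball (0 :: (complex ^ 'n ^ 'n ^ 'n) \<times> (real ^ 'n ^ 'n)) (1 / 2) \<times> {0..1::real} \<times>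
    cball (0 :: complex ^ 'n ^ 'n) (N * (N * 2)) \<times> cball (0 :: real ^ 'n) (\<Sum>i\<in>UNIV. \<bar>2 * B i\<bar>) \<times>
    cball (0 :: complex ^ 'n ^ 'n) (N * 1)"
  have "x \<in> K"
    if "x \<in> solution_set" for x
  proof -
    obtain \<theta> t A q u where x: "x = (\<theta>, t, A, q, u)" by (metis prod_cases5)
    have \<theta>: "norm \<theta> \<le> 1 / 2" and t: "t \<in> {0..1}" and q: "\<And>i. 0 \<le> q $ i"
      and u: "\<And>i. norm (u $ i) = 1" and sol: "solves \<theta> t A q u"
      using that by (auto simp: x solution_set_def)
    have n1: "norm (fst \<theta>) \<le> 1 / 2" and n2: "norm (snd \<theta>) \<le> 1 / 2"
      using \<theta> norm_fst_le[of "fst \<theta>" "snd \<theta>"] norm_snd_le[of "snd \<theta>" "fst \<theta>"] by auto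
    have A: "norm A \<le> N * (N * 2)"
      unfolding N_def
    proof (intro norm_vec_le_card)
      show "norm (A $ a $ b) \<le> 2" for a b
        using norm_entry_le_of_defect[OF _ t n2, of A] sol by (simp add: solves_def)
    qed
    \<comment> \<open>The bound 1/2 on the perturbation leaves the vector multiplied by
      \<open>q $ i\<close> with norm at least 1/2.\<close>
    have qB: "q $ i \<le> 2 * B i" for i
    proof -
      have "norm (fst \<theta> $ i) \<le> norm (fst \<theta>)"
        by (rule Finite_Cartesian_Product.norm_nth_le)
      then have "norm (fst \<theta> $ i *v (u $ i)) \<le> 1 / 2"
        using norm_matrix_vector_mult_le[of "fst \<theta> $ i" "u $ i"] n1 u[of i] by simp
      then have "norm (t *\<^sub>R (fst \<theta> $ i *v (u $ i))) \<le> 1 * (1 / 2)"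
        using t unfolding norm_scaleR by (intro mult_mono) auto
      moreover have "norm (ev i *s (u $ i)) = 1"
        using norm_ev u by (simp add: norm_vector_scalar_mult)
      ultimately have "1 / 2 \<le> norm (ev i *s (u $ i) + t *\<^sub>R (fst \<theta> $ i *v (u $ i)))"
        using norm_diff_ineq[of "ev i *s (u $ i)" "t *\<^sub>R (fst \<theta> $ i *v (u $ i))"] by simp
      then have "q $ i * (1 / 2) \<le> q $ i * norm (ev i *s (u $ i) + t *\<^sub>R (fst \<theta> $ i *v (u $ i)))"
        by (intro mult_left_mono q)
      also have "\<dots> = norm (p i (t, A) *v (u $ i))"
        using sol q[of i] by (simp add: solves_def)
      also have "\<dots> \<le> norm (p i (t, A))"
        using norm_matrix_vector_mult_le[of "p i (t, A)" "u $ i"] u[of i] by simp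
      also have "\<dots> \<le> B i"
        using A t by (intro B) auto
      finally show ?thesis by simp
    qed
    have "\<bar>q $ i\<bar> \<le> \<bar>2 * B i\<bar>" for i
      using q[of i] qB[of i] by linarith
    then have "norm q \<le> (\<Sum>i\<in>UNIV. \<bar>2 * B i\<bar>)"
      by (rule order_trans[OF norm_le_l1_cart sum_mono])
    moreover have "norm u \<le> N * 1"
      unfolding N_def using u by (intro norm_vec_le_card) auto
    ultimately show ?thesis
      using \<theta> t A by (simp add: x K_def)
  qed
  then have "solution_set \<subseteq> K" by blast
  moreover have "bounded K"
    unfolding K_def by (intro bounded_Times bounded_cball bounded_closed_interval)
  ultimately show ?thesis by (rule bounded_subset[rotated])
qed

lemma compact_solution_set: "compact solution_set"
  using closed_solution_set bounded_solution_set by (simp add: compact_eq_bounded_closed)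

text \<open>For \<open>\<theta> = 0\<close> the matrix \<open>A\<close> is unitary, so
  \<open>p_nonzero\<close> excludes a zero multiplier. On the compact set of solutions with
  \<open>q $ i = 0\<close> the norm of \<open>\<theta>\<close> is therefore bounded below.\<close>

lemma ex_threshold_multiplier_pos:
  obtains \<delta> where "0 < \<delta>" "\<And>\<theta> t A q u i. (\<theta>, t, A, q, u) \<in> solution_set \<Longrightarrow> norm \<theta> < \<delta> \<Longrightarrow> 0 < q $ i"
proof -
  have "\<exists>c>0. \<forall>x\<in>solution_set. fst (snd (snd (snd x))) $ i = 0 \<longrightarrow> c \<le> norm (fst x)" for i
  proof -
    define K where "K = solution_set \<inter> {x. fst (snd (snd (snd x))) $ i = 0}"
    have "compact K"
      unfolding K_def by (intro compact_Int_closed compact_solution_set closed_Collect_eq continuous_intros)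
    moreover have "continuous_on K (\<lambda>x. norm (fst x))"
      by (intro continuous_intros)
    moreover have "0 < norm (fst x)" if "x \<in> K" for x
    proof (rule ccontr)
      obtain \<theta> t A q u where x: "x = (\<theta>, t, A, q, u)" by (metis prod_cases5)
      assume "\<not> 0 < norm (fst x)"
      then have \<theta>: "\<theta> = 0" by (simp add: x)
      have *: "t \<in> {0..1}" "norm (u $ i) = 1" "solves \<theta> t A q u" "q $ i = 0"
        using that by (auto simp: K_def x solution_set_def)
      then have "A \<in> unitary_group"
        by (simp add: solves_def \<theta> flip: defect_eq_0_iff)
      moreover have "u $ i \<noteq> 0" using *(2) by auto
      ultimately have "p i (t, A) *v (u $ i) \<noteq> 0"
        using p_nonzero *(1) by blast
      then show False using *(3,4) by (simp add: solves_def)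
    qed
    ultimately have "\<exists>c>0. \<forall>x\<in>K. c \<le> norm (fst x)"
      by (rule compact_positive_lower_bound)
    then show ?thesis by (auto simp: K_def)
  qed
  then obtain c where c: "\<And>i. 0 < c i"
    "\<And>i x. x \<in> solution_set \<Longrightarrow> fst (snd (snd (snd x))) $ i = 0 \<Longrightarrow> c i \<le> norm (fst x)"
    by metis
  show thesis
  proof (rule that[of "Min (range c)"])
    show "0 < Min (range c)" using c(1) by simp
    fix \<theta> t A q u i
    assume x: "(\<theta>, t, A, q, u) \<in> solution_set" and "norm \<theta> < Min (range c)"
    then have "norm \<theta> < c i" by simp
    then have "q $ i \<noteq> 0" using c(2)[OF x, of i] by auto
    moreover have "0 \<le> q $ i" using x by (auto simp: solution_set_def)
    ultimately show "0 < q $ i" by simp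
  qed
qed

text \<open>The vanishing entry means that the solution lies at infinity in the affine chart.\<close>

definition degenerate where
  "degenerate \<theta> \<longleftrightarrow> (\<exists>t A q u j. 0 < t \<and> t \<le> 1 \<and> solves \<theta> t A q u \<and>
     (\<forall>i. u $ i \<noteq> 0) \<and> (\<forall>i. 0 < q $ i) \<and> u $ j $ j = 0)"

text \<open>The system is homogeneous in each vector, so the vectors matter only as points of
  projective spaces.\<close>

lemma solves_scale:
  assumes "solves \<theta> t A q u"
  shows "solves \<theta> t A q (\<chi> i. c i *s (u $ i))"
  using assms
  by (simp add: solves_def vector_scalar_commute)
    (simp add: vec_eq_iff algebra_simps)

lemma solution_set_normalize:
  assumes sol: "solves \<theta> t A q u" and "norm \<theta> \<le> 1 / 2" "t \<in> {0..1}" "\<And>i. 0 \<le> q $ i"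
    and u: "\<And>i. u $ i \<noteq> 0"
  shows "(\<theta>, t, A, q, (\<chi> i. of_real (1 / norm (u $ i)) *s (u $ i))) \<in> solution_set"
  unfolding solution_set_def using assms(2-4) u
  by (auto simp: norm_vector_scalar_mult norm_divide intro: solves_scale[OF sol])

lemma chart_nonzero: "chart R $ i \<noteq> 0"
  using chart_diag[of R i] by (metis zero_index zero_neq_one)

text \<open>Normalising the vectors maps zeros into a compact set on which neither the diagonal
  entries nor the multipliers vanish. Both are thus bounded away from 0, and this bounds the affine
  coordinates and the logarithms.\<close>

lemma bounded_zeros_residual:
  assumes \<theta>: "norm \<theta> \<le> 1 / 2" and nondeg: "\<not> degenerate \<theta>"
    and pos: "\<And>t A q u i. (\<theta>, t, A, q, u) \<in> solution_set \<Longrightarrow> 0 < q $ i"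
  shows "\<exists>r. \<forall>t\<in>{0..1}. \<forall>x. residual \<theta> (t, x) = 0 \<longrightarrow> norm (x - (D0, 0)) < r"
proof -
  define C where "C = solution_set \<inter> {x. fst x = \<theta>}"
  have C: "compact C"
    unfolding C_def by (intro compact_Int_closed compact_solution_set closed_Collect_eq continuous_intros)
  \<comment> \<open>At time 0 the diagonal entry is the only one that can be nonzero; at later times
    nondegeneracy applies.\<close>
  have u_nz: "u $ i $ i \<noteq> 0" if x: "(\<theta>, t, A, q, u) \<in> solution_set" for t A q u i
  proof (cases "t = 0")
    case True
    have "norm (u $ i) = 1" for i using x by (simp add: solution_set_def)
    then have "u $ i \<noteq> 0" for i by (metis norm_zero zero_neq_one)
    moreover from this have "b \<noteq> i \<Longrightarrow> u $ i $ b = 0" for b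
      using solves_at_0(4)[of \<theta> A q u] x True by (auto simp: solution_set_def)
    ultimately show ?thesis by (metis vec_eq_iff zero_index)
  next
    case False
    have "norm (u $ i) = 1" for i using x by (simp add: solution_set_def)
    then have nz: "\<forall>i. u $ i \<noteq> 0" by (metis norm_zero zero_neq_one)
    have t: "0 < t \<and> t \<le> 1" "solves \<theta> t A q u"
      using x False by (auto simp: solution_set_def)
    have q: "\<forall>i. 0 < q $ i"
      using pos[OF x] by blast
    show ?thesis
      using nondeg t nz q unfolding degenerate_def by blast
  qed
  have "\<exists>c>0. \<forall>x\<in>C. c \<le> norm (snd (snd (snd (snd x))) $ i $ i)" for i
  proof -
    have "0 < norm (snd (snd (snd (snd x))) $ i $ i)" if "x \<in> C" for x
    proof -
      obtain \<theta>' t A q u where "x = (\<theta>', t, A, q, u)"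
        by (metis prod_cases5)
      then show ?thesis using u_nz[of t A q u i] that by (auto simp: C_def)
    qed
    moreover have "continuous_on C (\<lambda>x. norm (snd (snd (snd (snd x))) $ i $ i))"
      by (intro continuous_intros)
    ultimately show ?thesis
      by (intro compact_positive_lower_bound[OF C])
  qed
  then obtain c where c: "\<And>i. 0 < c i" "\<And>i x. x \<in> C \<Longrightarrow> c i \<le> norm (snd (snd (snd (snd x))) $ i $ i)"
    by metis
  have "\<exists>d>0. \<forall>x\<in>C. d \<le> fst (snd (snd (snd x))) $ i" for i
  proof -
    have "0 < fst (snd (snd (snd x))) $ i" if "x \<in> C" for x
    proof -
      obtain \<theta>' t A q u where "x = (\<theta>', t, A, q, u)"
        by (metis prod_cases5)
      then show ?thesis using pos[of t A q u i] that by (auto simp: C_def)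
    qed
    moreover have "continuous_on C (\<lambda>x. fst (snd (snd (snd x))) $ i)"
      by (intro continuous_intros)
    ultimately show ?thesis
      by (intro compact_positive_lower_bound[OF C])
  qed
  then obtain d where d: "\<And>i. 0 < d i" "\<And>i x. x \<in> C \<Longrightarrow> d i \<le> fst (snd (snd (snd x))) $ i"
    by metis
  obtain B where B: "\<And>x. x \<in> C \<Longrightarrow> norm x \<le> B"
    using compact_imp_bounded[OF C] by (auto simp: bounded_iff)
  \<comment> \<open>\<open>B\<close> bounds \<open>A\<close> and the multipliers,
    \<open>1 / c i\<close> the chart vectors, and \<open>1 / d i\<close> the inverse multipliers;
    logarithms are compared with these through \<open>exp x \<ge> 1 + x\<close>.\<close>
  define M where "M = \<bar>B\<bar> + (\<Sum>i\<in>UNIV. 1 / c i) + (\<Sum>i\<in>UNIV. 1 / d i)"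
  have sums: "0 \<le> (\<Sum>i\<in>UNIV. 1 / c i)" "0 \<le> (\<Sum>i\<in>UNIV. 1 / d i)"
    using c(1) d(1) by (auto intro!: sum_nonneg simp: less_imp_le)
  have cM: "1 / c i \<le> (\<Sum>i\<in>UNIV. 1 / c i)" and dM: "1 / d i \<le> (\<Sum>i\<in>UNIV. 1 / d i)" for i
    using c(1) d(1) by (auto intro!: member_le_sum simp: less_imp_le)
  have "norm (x - (D0, 0)) < M + norm D0 + CARD('n) * (CARD('n) * M) + 1"
    if t: "t \<in> {0..1}" and zero: "residual \<theta> (t, x) = 0" for t x
  proof -
    obtain A R where x: "x = (A, R)" by fastforce
    define q where "q = (\<chi> i. exp (R $ i $ i))"
    define u where "u = (\<chi> i. of_real (1 / norm (chart R $ i)) *s (chart R $ i))"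
    have sol: "solves \<theta> t A q (chart R)"
      using zero by (simp add: x residual_eq_0_iff q_def)
    have xC: "(\<theta>, t, A, q, u) \<in> C"
      unfolding C_def u_def using solution_set_normalize[OF sol \<theta> t _ chart_nonzero]
      by (simp add: q_def)
    have chart_le: "norm (chart R $ i) \<le> 1 / c i" for i
    proof -
      have "c i \<le> 1 / norm (chart R $ i)"
        using c(2)[OF xC, of i] by (simp add: u_def norm_divide)
      then show ?thesis
        using c(1)[of i] chart_nonzero[of R i] by (simp add: field_simps)
    qed
    have B': "norm A \<le> B" "norm q \<le> B"
      using B[OF xC] norm_fst_le[of A "(q, u)"] norm_fst_le[of q u] norm_snd_le[of "(q, u)" A]
        norm_snd_le[of "(A, q, u)" t] norm_snd_le[of "(t, A, q, u)" \<theta>] by linarith+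
    have "\<bar>R $ a $ b\<bar> \<le> M" for a b
    proof -
      consider "a = b" | "a \<lhd> b" | "b \<lhd> a" using precedes_linear by blast
      then show ?thesis
      proof cases
        case 1
        have "exp (R $ a $ a) \<le> B"
          using B'(2) component_le_norm_cart[of q a] by (simp add: q_def)
        then have "R $ a $ a \<le> B"
          using exp_ge_add_one_self[of "R $ a $ a"] by linarith
        moreover have "exp (- R $ a $ a) \<le> 1 / d a"
          using d(2)[OF xC, of a] d(1)[of a] by (simp add: q_def exp_minus field_simps)
        then have "- R $ a $ a \<le> 1 / d a"
          using exp_ge_add_one_self[of "- R $ a $ a"] by simp
        ultimately have "\<bar>R $ a $ a\<bar> \<le> M"
          using dM[of a] sums unfolding M_def by linarith
        then show ?thesis using 1 by simp
      next
        case 2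
        have "\<bar>R $ a $ b\<bar> \<le> norm (chart R $ a $ b)"
          using 2 abs_Im_le_cmod[of "chart R $ a $ b"] by (auto simp: chart_nth offd_nth axis_def)
        also have "\<dots> \<le> norm (chart R $ a)"
          by (rule Finite_Cartesian_Product.norm_nth_le)
        finally show ?thesis
          using chart_le[of a] cM[of a] sums unfolding M_def by linarith
      next
        case 3
        have "\<bar>R $ a $ b\<bar> \<le> norm (chart R $ b $ a)"
          using 3 abs_Re_le_cmod[of "chart R $ b $ a"] by (auto simp: chart_nth offd_nth axis_def)
        also have "\<dots> \<le> norm (chart R $ b)"
          by (rule Finite_Cartesian_Product.norm_nth_le)
        finally show ?thesis
          using chart_le[of b] cM[of b] sums unfolding M_def by linarith
      qed
    qed
    then have "norm R \<le> CARD('n) * (CARD('n) * M)"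
      by (intro norm_vec_le_card) simp
    moreover have "norm (x - (D0, 0)) \<le> norm (A - D0) + norm R"
      using norm_Pair_le[of "A - D0" R] by (simp add: x)
    moreover have "norm (A - D0) \<le> norm A + norm D0"
      by (rule norm_triangle_ineq4)
    moreover have "norm A \<le> M"
      using B'(1) sums unfolding M_def by linarith
    ultimately show ?thesis by linarith
  qed
  then show ?thesis by blast
qed

lemma nondegenerate_solvable:
  assumes \<theta>: "norm \<theta> \<le> 1 / 2" and nondeg: "\<not> degenerate \<theta>"
    and pos: "\<And>t A q u i. (\<theta>, t, A, q, u) \<in> solution_set \<Longrightarrow> 0 < q $ i"
  shows "\<exists>A q u. (\<theta>, 1, A, q, u) \<in> solution_set"
proof -
  obtain r where r: "\<And>t x. t \<in> {0..1} \<Longrightarrow> residual \<theta> (t, x) = 0 \<Longrightarrow> norm (x - (D0, 0)) < r"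
    using bounded_zeros_residual[OF \<theta> nondeg] pos by blast
  have "\<exists>x. residual \<theta> (1, x) = 0"
    by (rule zero_of_homotopy_from_nondegenerate_zero[OF continuous_residual _ residual_0_zero
        has_derivative_residual_0 inj_L0]) (rule r)
  then obtain A R where "residual \<theta> (1, A, R) = 0" by auto
  then have "solves \<theta> 1 A (\<chi> i. exp (R $ i $ i)) (chart R)"
    by (simp add: residual_eq_0_iff)
  from solution_set_normalize[OF this \<theta> _ _ chart_nonzero] show ?thesis
    by auto
qed

end

section \<open>Generic perturbations\<close>

lemma differentiable_vec_lambda:
  fixes f :: "'a::real_normed_vector \<Rightarrow> 'n::finite \<Rightarrow> 'b::euclidean_space"
  assumes "\<And>i. (\<lambda>x. f x i) differentiable (at x within S)"
  shows "(\<lambda>x. \<chi> i. f x i) differentiable (at x within S)"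
proof -
  obtain f' where "\<And>i. ((\<lambda>x. f x i) has_derivative f' i) (at x within S)"
    using assms unfolding differentiable_def by metis
  then show ?thesis
    unfolding differentiable_def
    by (intro exI) (rule has_derivative_vec_lambda[where f' = "\<lambda>h i. f' i h"])
qed

lemma differentiable_vec_nth:
  "f differentiable F \<Longrightarrow> (\<lambda>x. f x $ i) differentiable F"
  unfolding differentiable_def by (blast intro: has_derivative_vec_nth)

lemma differentiable_linear_compose:
  assumes "bounded_linear L" "f differentiable F"
  shows "(\<lambda>x. L (f x)) differentiable F"
  using assms unfolding differentiable_def by (blast intro: bounded_linear.has_derivative)

lemma differentiable_bilinear_compose:
  assumes "bounded_bilinear B" "f differentiable (at x within S)" "g differentiable (at x within S)"
  shows "(\<lambda>x. B (f x) (g x)) differentiable (at x within S)"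
  using assms unfolding differentiable_def by (blast intro: bounded_bilinear.FDERIV)

definition swp :: "'n \<Rightarrow> 'n \<Rightarrow> 'n \<Rightarrow> 'n" where
  "swp a b c = (if c = a then b else if c = b then a else c)"

context eigenvector_system
begin

text \<open>Parametrises the degenerate parameters whose solution vectors \<open>u\<^sub>i\<close> have
  \<open>k i\<close>-th entry 1 and whose vector \<open>u\<^sub>j\<close> has \<open>j\<close>-th entry 0. Column \<open>k i\<close> of the
  \<open>i\<close>-th matrix is determined by the other data, so this slot of the argument is free to
  store column \<open>i\<close> of \<open>A\<close>; likewise the vanishing complex entry leaves two real slots,
  one of which stores the time \<open>t\<close> and the other has to vanish.\<close>

definition arg_A :: "('n \<Rightarrow> 'n) \<Rightarrow> (complex ^ 'n ^ 'n ^ 'n) \<times> (real ^ 'n ^ 'n) \<Rightarrow> complex ^ 'n ^ 'n" where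
  "arg_A k x = (\<chi> a b. fst x $ b $ a $ k b)"

text \<open>Exchanging the positions \<open>i\<close> and \<open>k i\<close> moves the entry 1 to
  position \<open>i\<close>, so that the other entries occupy slots as in \<open>offd\<close>. For
  \<open>i = j\<close> the exchange moves the vanishing \<open>j\<close>-th entry to position
  \<open>k j\<close>, whose two slots become free.\<close>

definition arg_u :: "('n \<Rightarrow> 'n) \<Rightarrow> 'n \<Rightarrow> (complex ^ 'n ^ 'n ^ 'n) \<times> (real ^ 'n ^ 'n) \<Rightarrow> complex ^ 'n ^ 'n" where
  "arg_u k j x = (\<chi> i b. let c = swp i (k i) b in
     if c = i then 1
     else if i \<lhd> c \<and> \<not> (i = j \<and> c = k j)
     then of_real (snd x $ c $ i) + \<i> * of_real (snd x $ i $ c) else 0)"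

text \<open>The equations solved for \<open>\<theta>\<close>: since \<open>u $ i $ k i = 1\<close>,
  column \<open>k i\<close> of the \<open>i\<close>-th matrix is the prescribed product minus the
  contribution of the other columns.\<close>

definition param where
  "param k j x = (let t = snd x $ k j $ j; A = arg_A k x; u = arg_u k j x in
    ((\<chi> i a b. if b = k i
       then (1 / t) *\<^sub>R ((exp (- (snd x $ i $ i)) *\<^sub>R (p i (t, A) *v (u $ i)) - ev i *s (u $ i)) $ a)
         - (\<Sum>l\<in>UNIV - {k i}. fst x $ i $ a $ l * u $ i $ l)
       else fst x $ i $ a $ b),
     (1 / t) *\<^sub>R defect A))"

definition param_domain :: "('n \<Rightarrow> 'n) \<Rightarrow> 'n \<Rightarrow> ((complex ^ 'n ^ 'n ^ 'n) \<times> (real ^ 'n ^ 'n)) set" where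
  "param_domain k j = {x. snd x $ j $ k j = 0 \<and> snd x $ k j $ j \<noteq> 0}"

lemma differentiable_param:
  assumes "snd x $ k j $ j \<noteq> 0"
  shows "param k j differentiable (at x)"
proof -
  have snds: "(\<lambda>x. snd x $ a $ b) differentiable (at x)" for a b and x :: "(complex ^ 'n ^ 'n ^ 'n) \<times> (real ^ 'n ^ 'n)"
    by (intro differentiable_vec_nth differentiable_linear_compose[OF bounded_linear_snd] differentiable_ident)
  have fsts: "(\<lambda>x. fst x $ a $ b $ c) differentiable (at x)" for a b c and x :: "(complex ^ 'n ^ 'n ^ 'n) \<times> (real ^ 'n ^ 'n)"
    by (intro differentiable_vec_nth differentiable_linear_compose[OF bounded_linear_fst] differentiable_ident)
  have A: "arg_A k differentiable (at x)"
    unfolding arg_A_def by (intro differentiable_vec_lambda fsts)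
  have of_real: "(\<lambda>x. complex_of_real (snd x $ a $ b)) differentiable (at x)" for a b
    by (intro differentiable_linear_compose[OF bounded_linear_of_real] snds)
  have "(\<lambda>x. arg_u k j x $ i $ b) differentiable (at x)" for i b
  proof -
    define c where "c = swp i (k i) b"
    have "(\<lambda>x. complex_of_real (snd x $ c $ i) + \<i> * complex_of_real (snd x $ i $ c)) differentiable (at x)"
      by (intro differentiable_add differentiable_mult differentiable_const of_real)
    then show ?thesis
      unfolding arg_u_def Let_def vec_lambda_beta c_def[symmetric]
      by (cases "c = i"; cases "i \<lhd> c \<and> \<not> (i = j \<and> c = k j)") auto
  qed
  then have "(\<lambda>x. \<chi> i. \<chi> b. arg_u k j x $ i $ b) differentiable (at x)"
    by (intro differentiable_vec_lambda)
  then have u: "arg_u k j differentiable (at x)" by simp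
  have t: "(\<lambda>x. 1 / snd x $ k j $ j) differentiable (at x)"
    using assms by (intro differentiable_divide differentiable_const snds)
  have "(\<lambda>x. snd x $ k j $ j) differentiable (at x)" by (rule snds)
  from differentiable_chain_at[OF differentiable_Pair[OF this A] p_differentiable]
  have pA: "(\<lambda>x. p i (snd x $ k j $ j, arg_A k x)) differentiable (at x)" for i
    by (simp add: o_def)
  have ui: "(\<lambda>x. arg_u k j x $ i) differentiable (at x)" for i
    by (rule differentiable_vec_nth[OF u])
  have "(\<lambda>x. - snd x $ i $ i) differentiable (at x)" for i
    by (intro differentiable_minus snds)
  from differentiable_chain_at[OF this field_differentiable_imp_differentiable[OF field_differentiable_within_exp]]
  have ex: "(\<lambda>x. exp (- snd x $ i $ i)) differentiable (at x)" for i
    by (simp add: o_def)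
  let ?col = "\<lambda>x i a. (1 / snd x $ k j $ j) *\<^sub>R ((exp (- (snd x $ i $ i)) *\<^sub>R
      (p i (snd x $ k j $ j, arg_A k x) *v (arg_u k j x $ i)) - ev i *s (arg_u k j x $ i)) $ a)
    - (\<Sum>l\<in>UNIV - {k i}. fst x $ i $ a $ l * arg_u k j x $ i $ l)"
  have top: "(\<lambda>x. \<chi> i a b. if b = k i then ?col x i a else fst x $ i $ a $ b) differentiable (at x)"
  proof (intro differentiable_vec_lambda)
    fix i a b
    have "(\<lambda>x. ?col x i a) differentiable (at x)"
      by (intro differentiable_diff differentiable_scaleR differentiable_vec_nth[where i = a] t ex
          differentiable_bilinear_compose[OF bounded_bilinear_matrix_vector_mult] pA ui
          differentiable_linear_compose[OF bounded_linear_vector_scalar_mult]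
          differentiable_sum finite_Diff finite differentiable_mult fsts differentiable_vec_nth[OF ui] ballI)
    then show "(\<lambda>x. if b = k i then ?col x i a else fst x $ i $ a $ b) differentiable (at x)"
      using fsts[of i a b] by (cases "b = k i") auto
  qed
  have bot: "(\<lambda>x. (1 / snd x $ k j $ j) *\<^sub>R defect (arg_A k x)) differentiable (at x)"
    by (intro differentiable_scaleR t differentiable_linear_compose[OF bounded_linear_pack]
        differentiable_diff differentiable_const A
        differentiable_bilinear_compose[OF bounded_bilinear_matrix_matrix_mult]
        differentiable_linear_compose[OF bounded_linear_conj_transpose])
  show ?thesis
    using differentiable_Pair[OF top bot] by (simp add: param_def[abs_def] Let_def)
qed

text \<open>The domain lies in a hyperplane, and a differentiable map between spaces of equal
  dimension preserves null sets. Of the two real codimensions, time uses up only one.\<close>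

lemma negligible_param_image: "negligible (param k j ` param_domain k j)"
proof (rule negligible_differentiable_image_negligible)
  let ?b = "(0, axis j (axis (k j) 1)) :: (complex ^ 'n ^ 'n ^ 'n) \<times> (real ^ 'n ^ 'n)"
  have "negligible {x. ?b \<bullet> x = 0}"
    by (rule negligible_hyperplane) (simp add: zero_prod_def axis_eq_0_iff)
  moreover have "param_domain k j \<subseteq> {x. ?b \<bullet> x = 0}"
    by (auto simp: param_domain_def inner_prod_def inner_axis')
  ultimately show "negligible (param_domain k j)"
    by (rule negligible_subset)
  show "param k j differentiable_on param_domain k j"
    by (rule differentiable_at_imp_differentiable_on) (simp add: param_domain_def differentiable_param)
qed simp

lemma degenerate_in_param_image:
  assumes "degenerate \<theta>"
  shows "\<exists>k j. \<theta> \<in> param k j ` param_domain k j"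
proof -
  obtain t A q v j where t: "0 < t" and sol': "solves \<theta> t A q v" and v: "\<And>i. v $ i \<noteq> 0"
    and q: "\<And>i. 0 < q $ i" and vj: "v $ j $ j = 0"
    using assms unfolding degenerate_def by blast
  have "\<exists>k. v $ i $ k \<noteq> 0" for i
    using v[of i] by (auto simp: vec_eq_iff)
  then obtain k where k: "\<And>i. v $ i $ k i \<noteq> 0" by metis
  define u where "u = (\<chi> i. (1 / v $ i $ k i) *s (v $ i))"
  have sol: "solves \<theta> t A q u"
    unfolding u_def by (rule solves_scale[OF sol'])
  have uk: "u $ i $ k i = 1" for i using k[of i] by (simp add: u_def)
  have uj: "u $ j $ j = 0" by (simp add: u_def vj)
  have low: "b \<lhd> i \<Longrightarrow> u $ i $ b = 0" for i b
    using sol by (simp add: solves_def)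
  have ki: "\<not> k i \<lhd> i" for i using low[of "k i" i] uk[of i] by auto
  \<comment> \<open>So the slots \<open>(k j, j)\<close> and \<open>(j, k j)\<close> are distinct
    and off the diagonal.\<close>
  have kj: "j \<lhd> k j" using uk[of j] uj precedes_linear ki by (metis zero_neq_one)
  \<comment> \<open>Slot \<open>(k j, j)\<close> receives the time; slot \<open>(j, k j)\<close>
    receives the imaginary part of \<open>u $ j $ j\<close> and so is 0.\<close>
  define x where "x = ((\<chi> i a b. if b = k i then A $ a $ i else fst \<theta> $ i $ a $ b),
    (\<chi> a b. if a = b then ln (q $ a)
       else if b \<lhd> a then (if b = j \<and> a = k j then t else Re (u $ b $ swp b (k b) a))
       else Im (u $ a $ swp a (k a) b)))"
  have xt: "snd x $ k j $ j = t"
    using kj by (auto simp: x_def)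
  have "snd x $ j $ k j = 0"
    using kj uj by (auto simp: x_def precedes_asym swp_def)
  then have dom: "x \<in> param_domain k j"
    using xt t by (simp add: param_domain_def)
  have xA: "arg_A k x = A"
    by (simp add: arg_A_def x_def vec_eq_iff)
  have "arg_u k j x $ i $ b = u $ i $ b" for i b
  proof -
    define c where "c = swp i (k i) b"
    have b: "b = swp i (k i) c" by (auto simp: c_def swp_def)
    consider "c = i" | "i \<lhd> c" "i = j" "c = k j" | "i \<lhd> c" "\<not> (i = j \<and> c = k j)" | "c \<lhd> i"
      using precedes_linear by blast
    then show ?thesis
    proof cases
      case 1
      then show ?thesis using uk[of i] b by (simp add: arg_u_def swp_def)
    next
      case 2
      then show ?thesis using uj b by (auto simp: arg_u_def Let_def swp_def split: if_splits)
    next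
      case 3
      then have "arg_u k j x $ i $ b = of_real (snd x $ c $ i) + \<i> * of_real (snd x $ i $ c)"
        by (auto simp: arg_u_def c_def[symmetric])
      also have "\<dots> = of_real (Re (u $ i $ b)) + \<i> * of_real (Im (u $ i $ b))"
        using 3 by (auto simp: x_def b[symmetric] precedes_asym)
      finally show ?thesis by (simp flip: complex_eq)
    next
      case 4
      then have "b = c" "b \<lhd> i" using ki[of i] b by (auto simp: swp_def split: if_splits)
      have "arg_u k j x $ i $ b = 0"
        using 4 by (auto simp: arg_u_def Let_def precedes_asym simp flip: c_def)
      then show ?thesis using low \<open>b \<lhd> i\<close> by simp
    qed
  qed
  then have xu: "arg_u k j x = u" by (simp add: vec_eq_iff)
  have "param k j x = \<theta>"
  proof (rule prod_eqI)
    have "fst (param k j x) $ i $ a $ b = fst \<theta> $ i $ a $ b" for i a b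
    proof (cases "b = k i")
      case True
      have "p i (t, A) *v (u $ i) = q $ i *\<^sub>R (ev i *s (u $ i) + t *\<^sub>R (fst \<theta> $ i *v (u $ i)))"
        using sol by (simp add: solves_def)
      then have "(1 / t) *\<^sub>R (exp (- (snd x $ i $ i)) *\<^sub>R (p i (t, A) *v (u $ i)) - ev i *s (u $ i)) = fst \<theta> $ i *v (u $ i)"
        using q[of i] t by (simp add: exp_minus x_def)
      moreover have "fst (param k j x) $ i $ a $ b =
          ((1 / t) *\<^sub>R (exp (- (snd x $ i $ i)) *\<^sub>R (p i (t, A) *v (u $ i)) - ev i *s (u $ i))) $ a
          - (\<Sum>l\<in>UNIV - {k i}. fst x $ i $ a $ l * u $ i $ l)"
        using True by (simp add: param_def Let_def xt xA xu)
      ultimately have "fst (param k j x) $ i $ a $ b = (fst \<theta> $ i *v (u $ i)) $ a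
          - (\<Sum>l\<in>UNIV - {k i}. fst x $ i $ a $ l * u $ i $ l)"
        by simp
      also have "(\<Sum>l\<in>UNIV - {k i}. fst x $ i $ a $ l * u $ i $ l) = (\<Sum>l\<in>UNIV - {k i}. fst \<theta> $ i $ a $ l * u $ i $ l)"
        by (intro sum.cong) (auto simp: x_def)
      also have "(fst \<theta> $ i *v (u $ i)) $ a = fst \<theta> $ i $ a $ k i * u $ i $ k i + (\<Sum>l\<in>UNIV - {k i}. fst \<theta> $ i $ a $ l * u $ i $ l)"
        by (simp add: matrix_vector_mult_def sum.remove[of UNIV "k i"])
      finally show ?thesis using True uk[of i] by simp
    next
      case False
      then show ?thesis by (simp add: param_def Let_def x_def)
    qed
    then show "fst (param k j x) = fst \<theta>" by (simp add: vec_eq_iff)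
    have "defect A = t *\<^sub>R snd \<theta>" using sol by (simp add: solves_def)
    then show "snd (param k j x) = snd \<theta>"
      using t by (simp add: param_def Let_def xt xA)
  qed
  then show ?thesis using dom by blast
qed

lemma negligible_degenerate: "negligible {\<theta>. degenerate \<theta>}"
proof -
  have "finite (UNIV :: (('n \<Rightarrow> 'n) \<times> 'n) set)" by simp
  then have "negligible (\<Union>(k, j)\<in>UNIV. param k j ` param_domain k j)"
    by (intro negligible_Union finite_imageI) (auto simp: negligible_param_image)
  moreover have "{\<theta>. degenerate \<theta>} \<subseteq> (\<Union>(k, j)\<in>UNIV. param k j ` param_domain k j)"
    using degenerate_in_param_image by fast
  ultimately show ?thesis by (rule negligible_subset)
qed

text \<open>Balls are not negligible, so nondegenerate parameters exist arbitrarily close to 0 and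
  have solutions at time 1. Compactness yields a solution for the parameter 0, where the
  perturbation has disappeared.\<close>

lemma ex_common_eigenvectors:
  "\<exists>A q u. A \<in> unitary_group \<and> (\<forall>i. u i \<noteq> 0 \<and> 0 \<le> q i \<and> p i (1, A) *v u i = (q i :: real) *\<^sub>R (ev i *s u i))"
proof -
  define C where "C = solution_set \<inter> {x. fst (snd x) = 1}"
  have "compact C"
    unfolding C_def by (intro compact_Int_closed compact_solution_set closed_Collect_eq continuous_intros)
  then have "compact (fst ` C)"
    by (intro compact_continuous_image continuous_intros)
  obtain \<delta> where \<delta>: "0 < \<delta>"
    "\<And>\<theta> t A q u i. (\<theta>, t, A, q, u) \<in> solution_set \<Longrightarrow> norm \<theta> < \<delta> \<Longrightarrow> 0 < q $ i"
    using ex_threshold_multiplier_pos by blast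
  have "0 \<in> closure (fst ` C)"
    unfolding closure_approachable
  proof (intro allI impI)
    fix e :: real assume "0 < e"
    define d where "d = min e (min \<delta> (1 / 2))"
    have "0 < d" using \<open>0 < e\<close> \<delta>(1) by (simp add: d_def)
    have "\<not> negligible (ball (0 :: (complex ^ 'n ^ 'n ^ 'n) \<times> (real ^ 'n ^ 'n)) d)"
      using open_not_negligible[of "ball (0 :: (complex ^ 'n ^ 'n ^ 'n) \<times> (real ^ 'n ^ 'n)) d"] \<open>0 < d\<close> by auto
    then obtain \<theta> where \<theta>: "\<theta> \<in> ball 0 d" "\<not> degenerate \<theta>"
      using negligible_subset[OF negligible_degenerate] by blast
    then have "norm \<theta> \<le> 1 / 2" "norm \<theta> < \<delta>" "norm \<theta> < e" by (auto simp: d_def)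
    then obtain A q u where "(\<theta>, 1, A, q, u) \<in> solution_set"
      using nondegenerate_solvable[OF _ \<theta>(2)] \<delta>(2) by blast
    then have "\<theta> \<in> fst ` C" by (force simp: C_def)
    then show "\<exists>y\<in>fst ` C. dist y 0 < e"
      using \<open>norm \<theta> < e\<close> by auto
  qed
  then have "0 \<in> fst ` C"
    using \<open>compact (fst ` C)\<close> compact_imp_closed closure_closed by blast
  then obtain A q u where *: "(0, 1, A, q, u) \<in> solution_set"
    by (auto simp: C_def)
  then have "A \<in> unitary_group"
    by (auto simp: solution_set_def solves_def simp flip: defect_eq_0_iff)
  moreover have "norm (u $ i) = 1" for i using * by (simp add: solution_set_def)
  then have "u $ i \<noteq> 0" for i by (metis norm_zero zero_neq_one)
  moreover have "p i (1, A) *v (u $ i) = q $ i *\<^sub>R (ev i *s (u $ i))" "0 \<le> q $ i" for i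
    using * by (simp_all add: solution_set_def solves_def)
  ultimately show ?thesis by blast
qed

end

section \<open>The lower bound\<close>

lemma categorical_contraction:
  assumes "categorical (top_of_set X) U" "X \<noteq> {}"
  shows "\<exists>H a. a \<in> X \<and> continuous_on ({0..1::real} \<times> U) H \<and> H ` ({0..1} \<times> U) \<subseteq> X \<and>
    (\<forall>x\<in>U. H (0, x) = x \<and> H (1, x) = a)"
\<comment> \<open>For empty \<open>U\<close> the homotopy does not place the constant in
  \<open>X\<close>, so any point of \<open>X\<close> is taken.\<close>
proof (cases "U = {}")
  case True
  then show ?thesis using assms(2) by auto
next
  case False
  have UX: "U \<subseteq> X"
    using assms(1) by (auto simp: categorical_def dest: openin_imp_subset)
  then have "subtopology (top_of_set X) U = top_of_set U"
    by (simp add: subtopology_subtopology Int_absorb1)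
  then obtain a where "homotopic_with_canon (\<lambda>_. True) U X id (\<lambda>_. a)"
    using assms(1) by (auto simp: categorical_def)
  then obtain H where H: "continuous_on ({0..1::real} \<times> U) H" "H \<in> {0..1} \<times> U \<rightarrow> X"
    "\<forall>x. H (0, x) = x" "\<forall>x. H (1, x) = a"
    unfolding homotopic_with_def by auto
  moreover have "a \<in> X"
    using False funcset_mem[OF H(2), of "(1, SOME x. x \<in> U)"] H(4) by (simp add: some_in_eq)
  ultimately show ?thesis
    by (intro exI[of _ H] exI[of _ a]) (simp add: image_subset_iff_funcset)
qed

text \<open>Each contraction is slowed down by a cutoff and extended by the identity. The cutoffs
  are chosen so that at every point at least one contraction runs to its end.\<close>

lemma ex_deformations_of_categorical_cover:
  fixes X :: "'a::euclidean_space set" and U :: "'i::finite \<Rightarrow> 'a set"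
  assumes cat: "\<And>i. categorical (top_of_set X) (U i)" and cover: "(\<Union>i. U i) = X" and "X \<noteq> {}"
  shows "\<exists>K (a :: 'i \<Rightarrow> 'a). (\<forall>i. a i \<in> X \<and> continuous_on ({0..1::real} \<times> X) (K i) \<and>
      (\<forall>t\<in>{0..1}. \<forall>x\<in>X. K i (t, x) \<in> X) \<and> (\<forall>x\<in>X. K i (0, x) = x)) \<and>
    (\<forall>x\<in>X. \<exists>i. K i (1, x) = a i)"
proof -
  obtain H a where a: "\<And>i. a i \<in> X" and H: "\<And>i. continuous_on ({0..1::real} \<times> U i) (H i)"
    "\<And>i. H i ` ({0..1} \<times> U i) \<subseteq> X" "\<And>i x. x \<in> U i \<Longrightarrow> H i (0, x) = x" "\<And>i x. x \<in> U i \<Longrightarrow> H i (1, x) = a i"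
    using categorical_contraction[OF cat \<open>X \<noteq> {}\<close>] by metis
  have "\<exists>d :: 'a \<Rightarrow> real. continuous_on X d \<and> (\<forall>x\<in>X. 0 \<le> d x \<and> (0 < d x \<longleftrightarrow> x \<in> U i))" for i
  \<comment> \<open>The whole space is separate because \<open>infdist\<close> to the empty set is
    0.\<close>
  proof (cases "U i = X")
    case True
    then show ?thesis by (intro exI[of _ "\<lambda>_. 1::real"]) auto
  next
    case False
    obtain O' where O': "open O'" "U i = X \<inter> O'"
      using cat[of i] by (auto simp: categorical_def openin_open)
    then have "- O' \<noteq> {}" "closed (- O')" using False by auto
    then show ?thesis
      using O' in_closed_iff_infdist_zero[of "- O'"]
      by (intro exI[of _ "\<lambda>x. infdist x (- O')"]) (auto intro!: continuous_intros simp: infdist_nonneg less_le)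
  qed
  then obtain d :: "'i \<Rightarrow> 'a \<Rightarrow> real" where d: "\<And>i. continuous_on X (d i)" "\<And>i x. x \<in> X \<Longrightarrow> 0 \<le> d i x"
    "\<And>i x. x \<in> X \<Longrightarrow> 0 < d i x \<longleftrightarrow> x \<in> U i" by metis
  define s where "s = (\<lambda>x. \<Sum>i\<in>UNIV. d i x)"
  define N where "N = real CARD('i)"
  have N: "0 < N" by (simp add: N_def)
  have s: "0 < s x" if "x \<in> X" for x
  proof -
    obtain i where "x \<in> U i" using \<open>x \<in> X\<close> cover by blast
    then show ?thesis
      unfolding s_def using d(2,3) \<open>x \<in> X\<close> by (intro sum_pos2[of _ i]) auto
  qed
  \<comment> \<open>\<open>\<phi> i\<close> is 0 where \<open>d i\<close> is at most half the
    average \<open>s / N\<close>, and 1 where it reaches the average, as some \<open>d i\<close>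
    always does.\<close>
  define \<phi> where "\<phi> = (\<lambda>i x. min 1 (max 0 (2 * N * d i x / s x - 1)))"
  have \<phi>_cont: "continuous_on X (\<phi> i)" for i
    unfolding \<phi>_def s_def using s by (intro continuous_intros d(1)) (auto simp: s_def less_imp_neq[symmetric])
  have \<phi>_01: "\<phi> i x \<in> {0..1}" for i x by (auto simp: \<phi>_def)
  define K where "K = (\<lambda>i z. if s (snd z) - 2 * N * d i (snd z) \<le> 0 then H i (fst z * \<phi> i (snd z), snd z) else snd z)"
  have inU: "x \<in> U i" if "x \<in> X" "s x - 2 * N * d i x \<le> 0" for i x
  proof -
    have "0 < 2 * N * d i x" using s[OF that(1)] that(2) by linarith
    then show ?thesis using N d(3)[OF that(1)] by (simp add: zero_less_mult_iff)
  qed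
  have t\<phi>: "t * \<phi> i x \<in> {0..1}" if "t \<in> {0..1}" for t i x
    using that \<phi>_01[of i x] by (auto intro: mult_le_one)
  show ?thesis
  proof (intro exI[of _ K] exI[of _ a] conjI allI ballI)
    show "continuous_on ({0..1::real} \<times> X) (K i)" for i
      unfolding K_def
    proof (rule continuous_on_cases_le)
      show "continuous_on {z \<in> {0..1} \<times> X. s (snd z) - 2 * N * d i (snd z) \<le> 0} (\<lambda>z. H i (fst z * \<phi> i (snd z), snd z))"
      proof (intro continuous_on_compose2[OF H(1)] continuous_intros continuous_on_compose2[OF \<phi>_cont])
        show "(\<lambda>z. (fst z * \<phi> i (snd z), snd z)) ` {z \<in> {0..1} \<times> X. s (snd z) - 2 * N * d i (snd z) \<le> 0} \<subseteq> {0..1} \<times> U i"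
        proof
          fix y assume "y \<in> (\<lambda>z. (fst z * \<phi> i (snd z), snd z)) ` {z \<in> {0..1} \<times> X. s (snd z) - 2 * N * d i (snd z) \<le> 0}"
          then obtain z where "y = (fst z * \<phi> i (snd z), snd z)" "z \<in> {0..1} \<times> X"
            "s (snd z) - 2 * N * d i (snd z) \<le> 0" by blast
          then show "y \<in> {0..1} \<times> U i"
            using t\<phi>[of "fst z" i "snd z"] inU[of "snd z" i] by (simp add: mem_Times_iff)
        qed
      qed auto
      show "continuous_on ({0..1} \<times> X) (\<lambda>z. s (snd z) - 2 * N * d i (snd z))"
        unfolding s_def by (intro continuous_intros continuous_on_compose2[OF d(1)]) auto
      show "H i (fst z * \<phi> i (snd z), snd z) = snd z"
        if "z \<in> {0..1} \<times> X" "s (snd z) - 2 * N * d i (snd z) = 0" for z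
      proof -
        have x: "snd z \<in> X" using that by auto
        have "2 * N * d i (snd z) = s (snd z)" using that(2) by simp
        then have "2 * N * d i (snd z) / s (snd z) = 1" using s[OF x] by (metis divide_self less_irrefl)
        then have "\<phi> i (snd z) = 0" by (simp add: \<phi>_def)
        then show ?thesis using H(3) inU[OF x, of i] that(2) by simp
      qed
    qed (intro continuous_intros)
    show "K i (t, x) \<in> X" if "t \<in> {0..1}" "x \<in> X" for i t x
      using H(2)[of i] t\<phi>[OF that(1), of i x] inU[OF that(2), of i] that(2) by (auto simp: K_def image_subset_iff)
    show "K i (0, x) = x" if "x \<in> X" for i x
      using H(3) inU[OF that] by (simp add: K_def)
    show "\<exists>i. K i (1, x) = a i" if x: "x \<in> X" for x
    proof -
      have "\<exists>i. s x / N \<le> d i x"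
      proof (rule ccontr)
        assume "\<not> ?thesis"
        then have "s x < (\<Sum>i\<in>(UNIV :: 'i set). s x / N)"
          unfolding s_def[of, THEN fun_cong, of x] by (intro sum_strict_mono) (auto simp: not_le s_def)
        then show False by (simp add: N_def)
      qed
      then obtain i where "s x / N \<le> d i x" by blast
      then have i: "s x \<le> N * d i x" using N by (simp add: field_simps)
      then have "1 \<le> 2 * N * d i x / s x - 1" using s[OF x] by (simp add: field_simps)
      then have "\<phi> i x = 1" by (simp add: \<phi>_def)
      moreover have le: "s x - 2 * N * d i x \<le> 0" using i s[OF x] by linarith
      ultimately show ?thesis using H(4)[OF inU[OF x le]] le by (auto simp: K_def intro!: exI[of _ i])
    qed
  qed (rule a)
qed

lemma ex_avoiding_deformations:
  fixes K :: "'n::finite \<Rightarrow> real \<times> (complex ^ 'n ^ 'n) \<Rightarrow> complex ^ 'n ^ 'n" and a :: "'n \<Rightarrow> complex ^ 'n ^ 'n"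
  assumes a: "\<And>i. a i \<in> unitary_group"
    and K: "\<And>i. continuous_on ({0..1} \<times> unitary_group) (K i)"
      "\<And>i t A. t \<in> {0..1} \<Longrightarrow> A \<in> unitary_group \<Longrightarrow> K i (t, A) \<in> unitary_group"
      "\<And>i A. A \<in> unitary_group \<Longrightarrow> K i (0, A) = A"
  shows "\<exists>A\<in>unitary_group. \<forall>i. K i (1, A) \<noteq> a i"
proof -
  let ?G = "unitary_group :: (complex ^ 'n ^ 'n) set"
  have "finite (\<Union>i. eigenvalues (a i))"
    by (intro finite_UN_I finite_class.finite_UNIV finite_eigenvalues_unitary a)
  then have "infinite (sphere 0 1 - (\<Union>i. eigenvalues (a i)))"
    using infinite_unit_circle by (rule Diff_infinite_finite)
  then obtain F where F: "F \<subseteq> sphere 0 1 - (\<Union>i. eigenvalues (a i))" "finite F" "card F = CARD('n)"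
    using infinite_arbitrarily_large by metis
  then obtain ev where ev: "bij_betw ev (UNIV :: 'n set) F"
    using finite_same_card_bij[of "UNIV :: 'n set" F] by auto
  then have evF: "ev i \<in> F" for i by (auto simp: bij_betw_def)
  have norm_ev: "norm (ev i) = 1" for i using evF[of i] F(1) by auto
  have ev_a: "ev i \<notin> eigenvalues (a i)" for i using evF[of i] F(1) by blast

  \<comment> \<open>As \<open>ev i\<close> is not an eigenvalue of \<open>a i\<close>, compactness
    of the sphere excludes even approximate unit eigenvectors.\<close>
  have "\<exists>c>0. \<forall>u\<in>sphere 0 1. c \<le> norm (a i *v u - ev i *s u)" for i
  proof (rule compact_positive_lower_bound)
    show "0 < norm (a i *v u - ev i *s u)" if "u \<in> sphere 0 1" for u
    proof -
      have "u \<noteq> 0" using that by auto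
      then show ?thesis using ev_a[of i] by (auto simp: eigenvalues_def)
    qed
  qed (intro continuous_intros | simp)+
  then obtain c where c: "\<And>i. 0 < c i" "\<And>i u. norm u = 1 \<Longrightarrow> c i \<le> norm (a i *v u - ev i *s u)"
    by (metis mem_sphere_0)
  \<comment> \<open>The bound 1/4 keeps \<open>p i (t, A)\<close> injective for unitary
    \<open>A\<close>; the division by 8 gives \<open>4 * e < c i\<close>, which yields the final
    contradiction.\<close>
  define e where "e = min (1 / 4) (Min (range c) / 8)"
  have e: "0 < e" "e \<le> 1 / 4" using c(1) by (auto simp: e_def)
  have ec: "4 * e < c i" for i
  proof -
    have "e \<le> Min (range c) / 8" unfolding e_def by (rule min.cobounded2)
    moreover have "Min (range c) \<le> c i" by simp
    ultimately show ?thesis using c(1)[of i] by linarith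
  qed

  have "\<exists>g. polynomial_function g \<and> (\<forall>z\<in>{0..1} \<times> ?G. norm (K i z - g z) < e)" for i
    by (rule Stone_Weierstrass_polynomial_function) (auto intro: compact_Times compact_unitary_group K e)
  then obtain g where g: "\<And>i. polynomial_function (g i)" "\<And>i z. z \<in> {0..1} \<times> ?G \<Longrightarrow> norm (K i z - g i z) < e"
    by metis
  \<comment> \<open>Correcting the polynomial approximation restores the exact identity at time 0
    and at most doubles the error.\<close>
  define p where "p = (\<lambda>i z. g i z - g i (0, snd z) + snd z)"
  have close: "norm (p i (t, A) *v u - K i (t, A) *v u) \<le> 2 * e * norm u" if "t \<in> {0..1}" "A \<in> ?G" for i t A u
  proof -
    have "p i (t, A) - K i (t, A) = (K i (0, A) - g i (0, A)) - (K i (t, A) - g i (t, A))"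
      by (simp add: p_def K(3)[OF that(2)])
    then have "norm (p i (t, A) - K i (t, A)) \<le> norm (K i (0, A) - g i (0, A)) + norm (K i (t, A) - g i (t, A))"
      by (metis norm_triangle_ineq4)
    also have "\<dots> \<le> 2 * e"
      using g(2)[of "(0, A)" i] g(2)[of "(t, A)" i] that by auto
    finally have "norm (p i (t, A) - K i (t, A)) * norm u \<le> 2 * e * norm u"
      by (rule mult_right_mono) simp
    then show ?thesis
      using norm_matrix_vector_mult_le[of "p i (t, A) - K i (t, A)" u]
      by (simp add: matrix_vector_mult_diff_rdistrib)
  qed
  interpret eigenvector_system p ev
  proof
    show "p i (0, A) = A" for i A by (simp add: p_def)
    show "p i differentiable at z" for i z
    proof -
      have "g i differentiable at y" for y
        by (rule differentiable_at_polynomial_function[OF g(1)])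
      moreover from differentiable_chain_at[OF _ this, of "\<lambda>z. (0, snd z)"]
      have "(\<lambda>z. g i (0, snd z)) differentiable at z"
        by (simp add: o_def differentiable_Pair differentiable_linear_compose[OF bounded_linear_snd])
      ultimately show ?thesis
        unfolding p_def by (intro differentiable_add differentiable_diff differentiable_linear_compose[OF bounded_linear_snd]) auto
    qed
    show "p i (t, A) *v u \<noteq> 0" if "t \<in> {0..1}" "A \<in> ?G" "u \<noteq> 0" for i t A u
    proof
      assume "p i (t, A) *v u = 0"
      then have "norm u \<le> 2 * e * norm u"
        using close[OF that(1,2), of i u] norm_unitary[OF K(2)[OF that(1,2)], of i u] by simp
      also have "\<dots> \<le> (1 / 2) * norm u" using e by (intro mult_right_mono) auto
      finally show False using that(3) by simp
    qed
    show "norm (ev i) = 1" for i by (rule norm_ev)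
    show "inj ev" using ev by (simp add: bij_betw_def)
  qed
  obtain A q u where A: "A \<in> ?G" and u: "\<And>i. u i \<noteq> 0" and q: "\<And>i. 0 \<le> q i"
    and eq: "\<And>i. p i (1, A) *v u i = q i *\<^sub>R (ev i *s u i)"
    using ex_common_eigenvectors by blast
  have "K i (1, A) \<noteq> a i" for i
  proof
    assume i: "K i (1, A) = a i"
    have 1: "norm (a i *v u i - q i *\<^sub>R (ev i *s u i)) \<le> 2 * e * norm (u i)"
      using close[of 1 A i "u i"] A by (simp add: i eq norm_minus_commute)
    have nev: "norm (ev i *s u i) = norm (u i)"
      by (simp add: norm_vector_scalar_mult norm_ev)
    \<comment> \<open>Since \<open>a i\<close> preserves norms, the multiplier is within
      \<open>2 * e\<close> of 1; dropping it raises the total error to \<open>4 * e\<close>.\<close>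
    have "\<bar>1 - q i\<bar> * norm (u i) = \<bar>norm (a i *v u i) - norm (q i *\<^sub>R (ev i *s u i))\<bar>"
      using q[of i] abs_mult[of "1 - q i" "norm (u i)"] by (simp add: a nev left_diff_distrib)
    also have "\<dots> \<le> 2 * e * norm (u i)"
      using norm_triangle_ineq3 1 by (rule order_trans)
    finally have 2: "norm (q i *\<^sub>R (ev i *s u i) - ev i *s u i) \<le> 2 * e * norm (u i)"
      by (simp add: nev abs_minus_commute flip: scaleR_left_diff_distrib[of _ 1, simplified])
    have 3: "norm (a i *v u i - ev i *s u i) \<le> 4 * e * norm (u i)"
      using norm_triangle_ineq[of "a i *v u i - q i *\<^sub>R (ev i *s u i)" "q i *\<^sub>R (ev i *s u i) - ev i *s u i"] 1 2
      by simp
    define w where "w = of_real (1 / norm (u i)) *s u i"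
    have "norm w = 1"
      using u[of i] by (simp add: w_def norm_vector_scalar_mult norm_divide)
    then have "c i \<le> norm (a i *v w - ev i *s w)" by (rule c)
    moreover have "a i *v w - ev i *s w = of_real (1 / norm (u i)) *s (a i *v u i - ev i *s u i)"
      by (simp add: w_def vector_scalar_commute)
    ultimately have "c i \<le> norm (complex_of_real (1 / norm (u i))) * norm (a i *v u i - ev i *s u i)"
      by (simp only: norm_vector_scalar_mult)
    also have "\<dots> = norm (a i *v u i - ev i *s u i) / norm (u i)"
      by (simp add: norm_divide)
    also have "\<dots> \<le> 4 * e"
      using 3 u[of i] by (simp add: field_simps)
    finally have "c i \<le> 4 * e" .
    then show False using ec[of i] by simp
  qed
  then show ?thesis using A by blast
qed

lemma mat_1_unitary: "(mat 1 :: complex ^ 'n ^ 'n) \<in> unitary_group"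
  by (rule unitaryI_norm) simp

lemma not_covered_by_dimension_many:
  fixes U :: "'n::finite \<Rightarrow> (complex ^ 'n ^ 'n) set"
  assumes cat: "\<And>i. categorical (top_of_set unitary_group) (U i)"
  shows "(\<Union>i. U i) \<noteq> unitary_group"
proof
  let ?G = "unitary_group :: (complex ^ 'n ^ 'n) set"
  assume cover: "(\<Union>i. U i) = ?G"
  have ne: "?G \<noteq> {}" using mat_1_unitary by blast
  show False
    using ex_deformations_of_categorical_cover[OF cat cover ne]
  proof (elim exE conjE)
    fix K and a :: "'n \<Rightarrow> complex ^ 'n ^ 'n"
    assume Ka: "\<forall>i. a i \<in> ?G \<and> continuous_on ({0..1::real} \<times> ?G) (K i) \<and>
        (\<forall>t\<in>{0..1}. \<forall>A\<in>?G. K i (t, A) \<in> ?G) \<and> (\<forall>A\<in>?G. K i (0, A) = A)"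
      and ex: "\<forall>A\<in>?G. \<exists>i. K i (1, A) = a i"
    have "\<exists>A\<in>?G. \<forall>i. K i (1, A) \<noteq> a i"
      by (rule ex_avoiding_deformations) (use Ka in simp_all)
    then show False using ex by blast
  qed
qed

theorem theorem4:
  shows "LS_cat (top_of_set (unitary_group :: (complex ^ 'n ^ 'n) set)) = enat CARD('n)"
proof (rule antisym[OF LS_cat_unitary_group_le])
  let ?G = "unitary_group :: (complex ^ 'n ^ 'n) set"
  have "enat (Suc CARD('n)) \<le> enat (card \<U>)"
    if fin: "finite \<U>" and cat: "\<forall>U\<in>\<U>. categorical (top_of_set ?G) U" and cover: "\<Union>\<U> = ?G" for \<U>
  proof (rule ccontr)
    assume "\<not> ?thesis"
    then have "card \<U> \<le> CARD('n)" by simp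
    then obtain f where f: "inj_on f \<U>" "f ` \<U> \<subseteq> (UNIV :: 'n set)"
      using card_le_inj[OF fin, of "UNIV :: 'n set"] by auto
    obtain V where "V \<in> \<U>" using cover mat_1_unitary[where 'n = 'n] by blast
    \<comment> \<open>A cover with fewer than \<open>CARD('n)\<close> members is padded by repeating
      \<open>V\<close>.\<close>
    define U where "U = (\<lambda>i. if i \<in> f ` \<U> then inv_into \<U> f i else V)"
    have U\<U>: "U i \<in> \<U>" for i
      using \<open>V \<in> \<U>\<close> by (auto simp: U_def inv_into_into)
    have "W = U (f W)" if "W \<in> \<U>" for W
      using that f(1) by (simp add: U_def)
    with U\<U> have "range U = \<U>" by blast
    then show False
      using not_covered_by_dimension_many[of U] cat cover U\<U> by auto
  qed
  then have "enat (Suc CARD('n)) \<le> (INF \<U> \<in> {\<U>. finite \<U> \<and> (\<forall>U\<in>\<U>. categorical (top_of_set ?G) U) \<and>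
      \<Union>\<U> = topspace (top_of_set ?G)}. enat (card \<U>))"
    by (intro INF_greatest) auto
  moreover have "enat m \<le> x - 1" if "enat (Suc m) \<le> x" for x m
    using that by (cases x) (auto simp: one_enat_def)
  ultimately show "enat CARD('n) \<le> LS_cat (top_of_set ?G)"
    unfolding LS_cat_def by blast
qed

end
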